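(* Let $K$ be an infinite field and let $\mathcal{X}$ be a linear subspace of $\operatorname{Mat}_{k,n}(K)$. Then $\frac{\operatorname{rk}(\mathcal{X}^{\{d\}})}{d}$ is weakly increasing in $d$ for $d\ge \frac{n}{2}-1$; that is, for every integer $d\ge 1$ with $d\ge \frac n2-1$, one has $\frac{\operatorname{rk}(\mathcal{X}^{\{d+1\}})}{d+1}\ge \frac{\operatorname{rk}(\mathcal{X}^{\{d\}})}{d}$.
   Context: $\operatorname{Mat}_{k,n}(K)$ is the space of $k\times n$ matrices over $K$. For a linear subspace $\mathcal{X}$ of matrices, $\operatorname{rk}(\mathcal{X})$ denotes the maximal rank among its members. For $d\ge 1$, the tensor blow-up is $\mathcal{X}^{\{d\}}=\mathcal{X}\otimes \operatorname{Mat}_{d,d}(K)=\{\sum_i X_i\otimes T_i \mid X_i\in\mathcal{X},\ T_i\in\operatorname{Mat}_{d,d}(K)\}$, viewed (via the Kronecker product) as a linear subspace of $\operatorname{Mat}_{kd,nd}(K)$. *)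

theory Defs
  imports "Jordan_Normal_Form.DL_Rank"
begin

(* Row (i1, i2) of A \<otimes> B is row i1 * dim_row B + i2, and likewise for columns. *)
definition kronecker :: "'a::semiring_1 mat \<Rightarrow> 'a mat \<Rightarrow> 'a mat" where
  "kronecker A B = mat (dim_row A * dim_row B) (dim_col A * dim_col B)
     (\<lambda>(i, j). A $$ (i div dim_row B, j div dim_col B) * B $$ (i mod dim_row B, j mod dim_col B))"

definition tensor_blow_up :: "nat \<Rightarrow> nat \<Rightarrow> nat \<Rightarrow> 'a::field mat set \<Rightarrow> 'a mat set" where
  "tensor_blow_up k n d \<X> =
     {(\<Oplus>\<^bsub>module_mat TYPE('a) (k * d) (n * d)\<^esub> i \<in> {..<m}. kronecker (X i) (T i)) | (m::nat) X T.
        (\<forall>i<m. X i \<in> \<X>) \<and> (\<forall>i<m. T i \<in> carrier_mat d d)}"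

(* The first argument of vec_space.rank is the number of rows. The maximum is over a finite
   nonempty set as soon as the matrices have a common format, see finite_ranks below. *)
definition max_rank :: "'a::field mat set \<Rightarrow> nat" where
  "max_rank \<X> = Max ((\<lambda>A. vec_space.rank (dim_row A) A) ` \<X>)"

lemma kronecker_carrier:
  assumes "A \<in> carrier_mat k n" "B \<in> carrier_mat d e"
  shows "kronecker A B \<in> carrier_mat (k * d) (n * e)"
  using assms by (auto simp: kronecker_def)

lemma finite_ranks:
  fixes \<X> :: "'a::field mat set"
  assumes "\<X> \<subseteq> carrier_mat r c"
  shows "finite ((\<lambda>A. vec_space.rank (dim_row A) A) ` \<X>)"
proof -
  have "vec_space.rank (dim_row A) A \<le> c" if "A \<in> \<X>" for A
    using that assms vec_space.rank_le_nc[of A r c] by auto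
  then show ?thesis
    by (intro finite_subset[OF _ finite_atMost[of c]]) auto
qed

lemma subspace_tensor_blow_up:
  fixes \<X> :: "'a::field mat set"
  assumes sub: "subspace class_ring \<X> (module_mat TYPE('a) k n)"
  shows "subspace class_ring (tensor_blow_up k n d \<X>) (module_mat TYPE('a) (k * d) (n * d))"
proof -
  let ?M = "module_mat TYPE('a) (k * d) (n * d)"
  interpret M: vectorspace class_ring ?M by (rule matrix_vs)
  note [simp] = module_mat_simps
  have X_carrier: "\<X> \<subseteq> carrier_mat k n"
    using sub unfolding subspace_def submodule_def by simp
  have kr: "kronecker A B \<in> carrier ?M" if "A \<in> \<X>" "B \<in> carrier_mat d d" for A B
    using that X_carrier kronecker_carrier[of A k n B d d] by auto
  have smult_X: "c \<cdot>\<^sub>m A \<in> \<X>" if "A \<in> \<X>" for c A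
  proof -
    have "submodule class_ring \<X> (module_mat TYPE('a) k n)" using sub unfolding subspace_def by simp
    from submodule.smult_closed[OF this _ that, of c] show ?thesis by (simp add: class_ring_simps)
  qed
  show ?thesis
    unfolding subspace_def
  proof (intro conjI matrix_vs)
    show "submodule class_ring (tensor_blow_up k n d \<X>) ?M"
    proof
      show "tensor_blow_up k n d \<X> \<subseteq> carrier ?M"
        unfolding tensor_blow_up_def using kr by (auto simp del: module_mat_simps intro!: M.finsum_closed)
    next
      fix v w assume "v \<in> tensor_blow_up k n d \<X>" "w \<in> tensor_blow_up k n d \<X>"
      then obtain p q :: nat and X T Y S where
        v: "v = (\<Oplus>\<^bsub>?M\<^esub> i \<in> {..<p}. kronecker (X i) (T i))"
        and w: "w = (\<Oplus>\<^bsub>?M\<^esub> i \<in> {..<q}. kronecker (Y i) (S i))"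
        and XT: "\<forall>i<p. X i \<in> \<X>" "\<forall>i<p. T i \<in> carrier_mat d d"
        and YS: "\<forall>i<q. Y i \<in> \<X>" "\<forall>i<q. S i \<in> carrier_mat d d"
        unfolding tensor_blow_up_def by blast
      define Z where "Z i = (if i < p then X i else Y (i - p))" for i
      define U where "U i = (if i < p then T i else S (i - p))" for i
      have ZU: "\<forall>i<p + q. Z i \<in> \<X>" "\<forall>i<p + q. U i \<in> carrier_mat d d"
        using XT YS by (auto simp: Z_def U_def)
      have c: "kronecker (Z i) (U i) \<in> carrier ?M" if "i < p + q" for i
        using ZU that kr by blast
      have split: "{..<p + q} = {..<p} \<union> {p..<p + q}" by auto
      have "(\<Oplus>\<^bsub>?M\<^esub> i \<in> {..<p + q}. kronecker (Z i) (U i))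
          = (\<Oplus>\<^bsub>?M\<^esub> i \<in> {..<p}. kronecker (Z i) (U i))
            \<oplus>\<^bsub>?M\<^esub> (\<Oplus>\<^bsub>?M\<^esub> i \<in> {p..<p + q}. kronecker (Z i) (U i))"
        unfolding split by (rule M.finsum_Un_disjoint) (use c in auto)
      also have "(\<Oplus>\<^bsub>?M\<^esub> i \<in> {..<p}. kronecker (Z i) (U i)) = v"
        unfolding v by (rule M.finsum_cong') (use kr XT in \<open>auto simp: Z_def U_def\<close>)
      also have "(\<Oplus>\<^bsub>?M\<^esub> i \<in> {p..<p + q}. kronecker (Z i) (U i)) = w"
      proof -
        have im: "{p..<p + q} = (\<lambda>i. i + p) ` {..<q}"
          by (simp add: lessThan_atLeast0 add.commute)
        have "(\<Oplus>\<^bsub>?M\<^esub> i \<in> {p..<p + q}. kronecker (Z i) (U i))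
            = (\<Oplus>\<^bsub>?M\<^esub> i \<in> {..<q}. kronecker (Z (i + p)) (U (i + p)))"
          unfolding im by (rule M.finsum_reindex) (use c in \<open>auto simp: add.commute\<close>)
        also have "\<dots> = w"
          unfolding w by (rule M.finsum_cong') (use kr YS in \<open>auto simp: Z_def U_def\<close>)
        finally show ?thesis .
      qed
      finally show "v \<oplus>\<^bsub>?M\<^esub> w \<in> tensor_blow_up k n d \<X>"
        unfolding tensor_blow_up_def using ZU by (auto simp del: module_mat_simps) metis
    next
      show "\<zero>\<^bsub>?M\<^esub> \<in> tensor_blow_up k n d \<X>"
        unfolding tensor_blow_up_def
        by (rule CollectI, rule exI[of _ "0::nat"]) (auto simp del: module_mat_simps)
    next
      fix c :: 'a and v assume "v \<in> tensor_blow_up k n d \<X>"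
      then obtain p :: nat and X T where
        v: "v = (\<Oplus>\<^bsub>?M\<^esub> i \<in> {..<p}. kronecker (X i) (T i))"
        and XT: "\<forall>i<p. X i \<in> \<X>" "\<forall>i<p. T i \<in> carrier_mat d d"
        unfolding tensor_blow_up_def by blast
      have eq: "c \<odot>\<^bsub>?M\<^esub> kronecker (X i) (T i) = kronecker (c \<cdot>\<^sub>m X i) (T i)" if "i < p" for i
      proof -
        have "X i \<in> carrier_mat k n" "T i \<in> carrier_mat d d" using XT X_carrier that by auto
        then show ?thesis
          by (auto simp: kronecker_def less_mult_imp_div_less intro!: eq_matI)
      qed
      have "c \<odot>\<^bsub>?M\<^esub> v = (\<Oplus>\<^bsub>?M\<^esub> i \<in> {..<p}. c \<odot>\<^bsub>?M\<^esub> kronecker (X i) (T i))"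
        unfolding v by (rule M.finsum_smult) (use kr XT in \<open>auto simp: class_ring_simps\<close>)
      also have "\<dots> = (\<Oplus>\<^bsub>?M\<^esub> i \<in> {..<p}. kronecker (c \<cdot>\<^sub>m X i) (T i))"
        by (rule M.finsum_cong') (use eq kr XT smult_X in auto)
      finally show "c \<odot>\<^bsub>?M\<^esub> v \<in> tensor_blow_up k n d \<X>"
        unfolding tensor_blow_up_def using XT smult_X by (auto simp del: module_mat_simps) metis
    qed
  qed
qed

end

theory Submission
  imports Defs
begin

text \<open>Write \<open>r\<^sub>d\<close> for the maximal rank in the \<open>d\<close>-th blow-up of \<open>\<X>\<close>. Three facts carry the proof.

  (1) Over an infinite field \<open>r\<^sub>d\<close> is divisible by \<open>d\<close> (\<open>size_dvd_max_rank_blow_up\<close>).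

  (2) Block diagonal matrices give \<open>r\<^sub>d\<^sub>+\<^sub>1 \<ge> r\<^sub>d + r\<^sub>1\<close> (\<open>blow_up_superadditive\<close>).

  (3) \<open>r\<^sub>d < 2 d r\<^sub>1\<close> unless \<open>r\<^sub>d = 0\<close> (\<open>blow_up_rank_less\<close>).

  By (1), \<open>r\<^sub>d = d s\<close> and \<open>r\<^sub>d\<^sub>+\<^sub>1 = (d + 1) t\<close> with natural numbers \<open>s\<close>, \<open>t\<close>, and the claim is \<open>s \<le> t\<close>. If
  \<open>t \<le> s - 1\<close>, then (2) gives \<open>d s + r\<^sub>1 \<le> (d + 1) (s - 1)\<close>, hence \<open>r\<^sub>1 \<le> s - d - 1\<close>, while (3) gives \<open>s < 2 r\<^sub>1\<close>.
  Together \<open>s > 2 d + 2\<close>, which contradicts \<open>s \<le> n \<le> 2 d + 2\<close>. It is the strictness in (3) that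
  makes the bound \<open>d \<ge> n / 2 - 1\<close> sufficient.

  Fact (1) is usually derived from a division algebra of degree \<open>d\<close>. Here only the valuation behind
  that argument is kept. Put a new variable \<open>w\<close> into the entries of a blow-up matrix that lie below
  the diagonal of their \<open>d \<times> d\<close> block. The blow-up is stable under conjugation with the cyclic
  permutation of the \<open>d\<close> block coordinates, and on the matrices with \<open>w\<close> it becomes
  conjugation with a \<open>d \<times> d\<close> cyclic monomial matrix whose nonzero entries are
  one \<open>w\<close> and otherwise \<open>1\<close>. Let \<open>h(I, J)\<close> be the
  degree in \<open>w\<close> of a generic minor of the maximal size \<open>r\<^sub>d\<close>. Conjugation relates \<open>h(I + 1, J + 1)\<close>
  to \<open>h(I, J)\<close> up to the number of indices that wrap around, and since the matrix of all maximal
  minors has rank one, \<open>h(I, J)\<close> is a sum of a function of \<open>I\<close> and a function of \<open>J\<close>. Summing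
  over a full turn of \<open>I\<close>, every index wraps around exactly once, so that \<open>r\<^sub>d\<close> is a multiple of \<open>d\<close>.

  Fact (3) is an induction on \<open>r = r\<^sub>1\<close>. If \<open>A\<close> has maximal rank in the space and is brought to the
  form \<open>diag(1, 0)\<close>, every member of the space is a block matrix with blocks \<open>*\<close>, \<open>B\<close>, \<open>C\<close>, \<open>0\<close>, and
  \<open>C B = 0\<close>. So the generic ranks of \<open>B\<close> and \<open>C\<close> add up to at most \<open>r\<close>, one of them is at most \<open>r / 2\<close>,
  and by induction the blow-up of that block has rank less than \<open>d r\<close>. The remaining blocks contribute
  at most \<open>d r\<close>.\<close>

section \<open>Rank through one-sided inverses, minors and factorizations\<close>

text \<open>The ring laws for matrices with side conditions on dimensions only, so that the simplifier can
  discharge them without guessing the middle dimensions.\<close>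

lemma assoc_mult_mat_dim:
  fixes A :: "'a::semiring_0 mat"
  shows "dim_col A = dim_row B \<Longrightarrow> dim_col B = dim_row C \<Longrightarrow> A * B * C = A * (B * C)"
  by (rule assoc_mult_mat[of A "dim_row A" "dim_col A" B "dim_col B" C "dim_col C"]) auto

lemma mult_minus_mat_dim:
  fixes A :: "'a::ring mat"
  shows "dim_row B = dim_row C \<Longrightarrow> dim_col B = dim_col C \<Longrightarrow> dim_col A = dim_row B
    \<Longrightarrow> A * (B - C) = A * B - A * C"
  by (rule mult_minus_distrib_mat[of A "dim_row A" "dim_col A" B "dim_col B"]) auto

lemma minus_mult_mat_dim:
  fixes A :: "'a::ring mat"
  shows "dim_row A = dim_row B \<Longrightarrow> dim_col A = dim_col B \<Longrightarrow> dim_col A = dim_row C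
    \<Longrightarrow> (A - B) * C = A * C - B * C"
  by (rule minus_mult_distrib_mat[of A "dim_row A" "dim_col A" B C "dim_col C"]) auto

lemma mult_add_mat_dim:
  fixes A :: "'a::semiring_0 mat"
  shows "dim_row B = dim_row C \<Longrightarrow> dim_col B = dim_col C \<Longrightarrow> dim_col A = dim_row B
    \<Longrightarrow> A * (B + C) = A * B + A * C"
  by (rule mult_add_distrib_mat[of A "dim_row A" "dim_col A" B "dim_col B"]) auto

lemma add_mult_mat_dim:
  fixes A :: "'a::semiring_0 mat"
  shows "dim_row A = dim_row B \<Longrightarrow> dim_col A = dim_col B \<Longrightarrow> dim_col A = dim_row C
    \<Longrightarrow> (A + B) * C = A * C + B * C"
  by (rule add_mult_distrib_mat[of A "dim_row A" "dim_col A" B C "dim_col C"]) auto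

lemma mult_smult_mat_dim:
  fixes A :: "'a::comm_semiring_0 mat"
  shows "dim_col A = dim_row B \<Longrightarrow> A * (c \<cdot>\<^sub>m B) = c \<cdot>\<^sub>m (A * B)"
  by (rule mult_smult_distrib[of A "dim_row A" "dim_col A" B "dim_col B"]) auto

lemma smult_mult_mat_dim:
  fixes A :: "'a::comm_semiring_0 mat"
  shows "dim_col A = dim_row B \<Longrightarrow> (c \<cdot>\<^sub>m A) * B = c \<cdot>\<^sub>m (A * B)"
  by (rule mult_smult_assoc_mat[of A "dim_row A" "dim_col A" B "dim_col B"]) auto

lemma minus_self_mat: "A - A = (0\<^sub>m (dim_row A) (dim_col A) :: 'a::group_add mat)"
  by (rule eq_matI) auto

lemmas mat_dim_simps = assoc_mult_mat_dim mult_minus_mat_dim minus_mult_mat_dim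
  mult_add_mat_dim add_mult_mat_dim mult_smult_mat_dim smult_mult_mat_dim minus_self_mat

lemma det_factor_through_smaller:
  fixes U :: "'a::idom mat"
  assumes U: "U \<in> carrier_mat c r" and V: "V \<in> carrier_mat r c" and "r < c"
  shows "det (U * V) = 0"
proof -
  define U' where "U' = mat c c (\<lambda>(i, j). if j < r then U $$ (i, j) else 0)"
  define V' where "V' = mat c c (\<lambda>(i, j). if i < r then V $$ (i, j) else 0)"
  have U': "U' \<in> carrier_mat c c" and V': "V' \<in> carrier_mat c c"
    by (auto simp: U'_def V'_def)
  have "U * V = U' * V'"
  proof (rule eq_matI)
    fix i j assume "i < dim_row (U' * V')" "j < dim_col (U' * V')"
    then have ij: "i < c" "j < c" by (auto simp: U'_def V'_def)
    have "(U' * V') $$ (i, j) = (\<Sum>l\<in>{0..<c}. U' $$ (i, l) * V' $$ (l, j))"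
      using ij by (simp add: U'_def V'_def scalar_prod_def)
    also have "\<dots> = (\<Sum>l\<in>{0..<r}. U $$ (i, l) * V $$ (l, j))"
      using ij \<open>r < c\<close> by (intro sum.mono_neutral_cong_right) (auto simp: U'_def V'_def)
    also have "\<dots> = (U * V) $$ (i, j)"
      using ij U V by (simp add: scalar_prod_def)
    finally show "(U * V) $$ (i, j) = (U' * V') $$ (i, j)" by simp
  qed (use U V U' V' in auto)
  also have "det \<dots> = det U' * det V'"
    by (rule det_mult[OF U' V'])
  also have "det V' = 0"
  proof -
    have "det V' = (\<Sum>j<c. V' $$ (c - 1, j) * cofactor V' (c - 1) j)"
      by (rule laplace_expansion_row[OF V']) (use \<open>r < c\<close> in simp)
    also have "\<dots> = 0"
      using \<open>r < c\<close> by (intro sum.neutral) (auto simp: V'_def)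
    finally show ?thesis .
  qed
  finally show ?thesis by simp
qed

lemma mult_mat_mult_index:
  assumes "i < dim_row F" "j < dim_col E" "dim_col A = dim_row E" "dim_col F = dim_row A"
  shows "(F * (A * E)) $$ (i, j) = row F i \<bullet> (A *\<^sub>v col E j)"
proof -
  have "col (A * E) j = A *\<^sub>v col E j"
    using assms by (intro col_mult2[of A "dim_row A" "dim_col A" E "dim_col E"]) auto
  then show ?thesis using assms by simp
qed

lemma identity_factor_le:
  fixes U :: "'a::idom mat"
  assumes "U \<in> carrier_mat c r" "V \<in> carrier_mat r c" "U * V = 1\<^sub>m c"
  shows "c \<le> r"
  using det_factor_through_smaller[OF assms(1,2)] assms(3) by (cases "r < c") auto

text \<open>A certificate for a lower bound on the rank. For fixed \<open>F\<close> and \<open>E\<close> the invertibility of \<open>F A E\<close> is a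
  polynomial condition on \<open>A\<close>, which makes lower rank bounds generic conditions.\<close>

definition rank_at_least :: "nat \<Rightarrow> 'a::field mat \<Rightarrow> bool" where
  "rank_at_least c A \<longleftrightarrow> (\<exists>F \<in> carrier_mat c (dim_row A). \<exists>E \<in> carrier_mat (dim_col A) c. F * A * E = 1\<^sub>m c)"

lemma rank_at_leastI_det:
  fixes A :: "'a::field mat"
  assumes A: "A \<in> carrier_mat k n" and F: "F \<in> carrier_mat c k" and E: "E \<in> carrier_mat n c"
    and det: "det (F * A * E) \<noteq> 0"
  shows "rank_at_least c A"
proof -
  have C: "F * A * E \<in> carrier_mat c c" using A F E by auto
  from det_non_zero_imp_unit[OF C det, of "()"] obtain G where
    G: "G \<in> carrier_mat c c" "F * A * E * G = 1\<^sub>m c"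
    unfolding Units_def ring_mat_def by auto
  have "F * A * (E * G) = 1\<^sub>m c"
    using G A F E by (simp add: assoc_mult_mat_dim)
  then show ?thesis
    unfolding rank_at_least_def using A F E G by (intro bexI[of _ F] bexI[of _ "E * G"]) auto
qed

lemma rank_at_least_factor_le:
  fixes A :: "'a::field mat"
  assumes "rank_at_least c A" and A: "A = P * Q" and P: "P \<in> carrier_mat k r" and Q: "Q \<in> carrier_mat r n"
  shows "c \<le> r"
proof -
  obtain F E where F: "F \<in> carrier_mat c k" and E: "E \<in> carrier_mat n c" and "F * A * E = 1\<^sub>m c"
    using assms unfolding rank_at_least_def by auto
  then have "(F * P) * (Q * E) = 1\<^sub>m c"
    using P Q A by (simp add: assoc_mult_mat_dim)
  then show ?thesis
    using F P Q E by (intro identity_factor_le[of "F * P" c r "Q * E"]) auto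
qed

text \<open>Take a certificate \<open>F A E = 1\<close> of maximal size. If \<open>D = A - A E F A\<close> had a nonzero entry, then because
  of \<open>F D = 0\<close> and \<open>D E = 0\<close> one could add a row to \<open>F\<close> and a column to \<open>E\<close>. So \<open>A = A E F A\<close>, and \<open>E F\<close>
  is a generalized inverse of \<open>A\<close>. It replaces a normal form of \<open>A\<close> under row and column operations.\<close>

lemma generalized_inverse_exists:
  fixes A :: "'a::field mat"
  assumes A: "A \<in> carrier_mat k n"
  obtains c F E where "F \<in> carrier_mat c k" "E \<in> carrier_mat n c"
    "F * A * E = 1\<^sub>m c" "A * E * F * A = A"
proof -
  have le: "c \<le> k" if "rank_at_least c A" for c
    using rank_at_least_factor_le[OF that, of "1\<^sub>m k" A k k n] A by auto
  have "rank_at_least 0 A"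
    unfolding rank_at_least_def
    by (intro bexI[of _ "0\<^sub>m 0 (dim_row A)"] bexI[of _ "0\<^sub>m (dim_col A) 0"]) auto
  then obtain c where c: "rank_at_least c A" and max: "\<And>c'. rank_at_least c' A \<Longrightarrow> c' \<le> c"
    using le ex_has_greatest_nat[of "\<lambda>c. rank_at_least c A" 0 id k] by force
  from c obtain F E where F: "F \<in> carrier_mat c k" and E: "E \<in> carrier_mat n c"
    and FAE: "F * A * E = 1\<^sub>m c"
    using A unfolding rank_at_least_def by auto
  note dims [simp] = carrier_matD[OF A] carrier_matD[OF F] carrier_matD[OF E]
  have FAE': "F * (A * E) = 1\<^sub>m c"
    using FAE by (simp add: assoc_mult_mat_dim)
  have FAEX: "F * (A * (E * X)) = X" if "dim_row X = c" for X
  proof -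
    have "F * (A * (E * X)) = F * A * E * X" using that by (simp add: assoc_mult_mat_dim)
    then show ?thesis using that by (simp add: FAE)
  qed
  define D where "D = A - A * E * F * A"
  have D: "D \<in> carrier_mat k n" by (rule carrier_matI) (simp_all add: D_def)
  have "D = 0\<^sub>m k n"
  proof (rule ccontr)
    assume "D \<noteq> 0\<^sub>m k n"
    moreover have "D = 0\<^sub>m k n" if "\<forall>i<k. \<forall>j<n. D $$ (i, j) = 0"
      using that D by (intro eq_matI) auto
    ultimately obtain i j where ij: "i < k" "j < n" "D $$ (i, j) \<noteq> 0"
      by blast
    define u where "u = mat 1 k (\<lambda>(_, p). if p = i then 1 else (0::'a))"
    define v where "v = mat n 1 (\<lambda>(q, _). if q = j then 1 / D $$ (i, j) else (0::'a))"
    have [simp]: "dim_row u = 1" "dim_col u = k" "dim_row v = n" "dim_col v = 1"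
      by (auto simp: u_def v_def)
    have uDv: "u * D * v = 1\<^sub>m 1"
    proof (rule eq_matI)
      fix a b assume "a < dim_row (1\<^sub>m 1 :: 'a mat)" "b < dim_col (1\<^sub>m 1 :: 'a mat)"
      then have [simp]: "a = 0" "b = 0" by auto
      have u: "row u 0 = unit_vec k i" and v: "col v 0 = (1 / D $$ (i, j)) \<cdot>\<^sub>v unit_vec n j"
        using ij by (auto simp: u_def v_def)
      have "(u * D * v) $$ (0, 0) = row u 0 \<bullet> (D *\<^sub>v col v 0)"
        using D by (simp add: assoc_mult_mat_dim mult_mat_mult_index del: index_mult_mat(1))
      also have "D *\<^sub>v col v 0 = (1 / D $$ (i, j)) \<cdot>\<^sub>v col D j"
        unfolding v using ij D by (intro eq_vecI) auto
      also have "row u 0 \<bullet> \<dots> = 1"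
        unfolding u using ij D by (simp add: scalar_prod_left_unit)
      finally show "(u * D * v) $$ (a, b) = 1\<^sub>m 1 $$ (a, b)" by simp
    qed auto
    have uDv': "u * (D * v) = 1\<^sub>m 1"
      using uDv D by (simp add: assoc_mult_mat_dim)
    \<comment> \<open>\<open>u\<close> and \<open>v\<close> pick out a nonzero entry of \<open>D\<close>. The corrections make \<open>F2 A\<close> and \<open>A E2\<close> factor through \<open>D\<close>.\<close>
    define F2 where "F2 = u - u * A * E * F"
    define E2 where "E2 = v - E * F * A * v"
    have [simp]: "dim_row F2 = 1" "dim_col F2 = k" "dim_row E2 = n" "dim_col E2 = 1"
      by (auto simp: F2_def E2_def)
    have AE2: "A * E2 = D * v" and F2A: "F2 * A = u * D"
      by (simp_all add: E2_def F2_def D_def mat_dim_simps)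
    have FD: "F * (D * X) = 0\<^sub>m c (dim_col X)" if "dim_row X = n" for X
      using that by (simp add: D_def mat_dim_simps FAEX)
    have DE: "D * E = 0\<^sub>m k c"
      by (simp add: D_def mat_dim_simps FAE')
    have DE2: "u * (D * E2) = 1\<^sub>m 1"
    proof -
      have "D * E2 = D * v - D * E * F * A * v"
        using D by (simp add: E2_def mat_dim_simps)
      also have "\<dots> = D * v"
        unfolding DE using D by (auto intro!: eq_matI)
      finally show ?thesis using uDv' by simp
    qed
    have F2AE: "F2 * (A * E) = 0\<^sub>m 1 c"
    proof -
      have "F2 * (A * E) = F2 * A * E" by (simp add: assoc_mult_mat_dim)
      also have "\<dots> = u * (D * E)" using D by (simp only: F2A) (simp add: assoc_mult_mat_dim)
      finally show ?thesis by (simp add: DE)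
    qed
    have F2AE2: "F2 * (A * E2) = 1\<^sub>m 1"
    proof -
      have "F2 * (A * E2) = F2 * A * E2" by (simp add: assoc_mult_mat_dim)
      also have "\<dots> = u * (D * E2)" using D by (simp only: F2A) (simp add: assoc_mult_mat_dim)
      finally show ?thesis by (simp add: DE2)
    qed
    have FAE2: "F * (A * E2) = 0\<^sub>m c 1" by (simp add: AE2 FD)
    define F' where "F' = mat (c + 1) k (\<lambda>(i, j). if i < c then F $$ (i, j) else F2 $$ (0, j))"
    define E' where "E' = mat n (c + 1) (\<lambda>(i, j). if j < c then E $$ (i, j) else E2 $$ (i, 0))"
    have F'c: "F' \<in> carrier_mat (c + 1) k" and E'c: "E' \<in> carrier_mat n (c + 1)"
      by (auto simp: F'_def E'_def)
    have row: "row F' i = (if i < c then row F i else row F2 0)" if "i < c + 1" for i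
      using that by (intro eq_vecI) (auto simp: F'_def)
    have col: "col E' j = (if j < c then col E j else col E2 0)" if "j < c + 1" for j
      using that by (intro eq_vecI) (auto simp: E'_def)
    have "F' * (A * E') = 1\<^sub>m (c + 1)"
    proof (rule eq_matI)
      fix i j assume "i < dim_row (1\<^sub>m (c + 1) :: 'a mat)" "j < dim_col (1\<^sub>m (c + 1) :: 'a mat)"
      then have ij: "i < c + 1" "j < c + 1" by auto
      have "(F' * (A * E')) $$ (i, j) = row F' i \<bullet> (A *\<^sub>v col E' j)"
        using ij F'c E'c by (intro mult_mat_mult_index) auto
      also have "\<dots> = (if i < c then if j < c then (F * (A * E)) $$ (i, j) else (F * (A * E2)) $$ (i, 0)
          else if j < c then (F2 * (A * E)) $$ (0, j) else (F2 * (A * E2)) $$ (0, 0))"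
        using ij by (auto simp: row col mult_mat_mult_index simp del: index_mult_mat(1))
      also have "\<dots> = 1\<^sub>m (c + 1) $$ (i, j)"
        using ij by (auto simp: FAE' FAE2 F2AE F2AE2 simp del: index_mult_mat(1))
      finally show "(F' * (A * E')) $$ (i, j) = 1\<^sub>m (c + 1) $$ (i, j)" .
    qed (use F'c E'c in auto)
    then have "F' * A * E' = 1\<^sub>m (c + 1)"
      using A F'c E'c by (simp add: assoc_mult_mat_dim)
    then have "rank_at_least (c + 1) A"
      unfolding rank_at_least_def using F'c E'c by auto
    then show False using max[of "c + 1"] by simp
  qed
  then have "A * E * F * A = A"
  proof -
    have "A $$ (i, j) - (A * E * F * A) $$ (i, j) = 0" if "i < k" "j < n" for i j
    proof -
      have "D $$ (i, j) = 0" using \<open>D = 0\<^sub>m k n\<close> that by simp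
      then show ?thesis using that unfolding D_def by (simp del: index_mult_mat(1))
    qed
    then show ?thesis by (intro eq_matI) (auto simp del: index_mult_mat(1))
  qed
  with F E FAE show thesis by (rule that)
qed

lemma rank_factorization:
  fixes A :: "'a::field mat"
  assumes A: "A \<in> carrier_mat k n"
  obtains c U V where "rank_at_least c A" "U \<in> carrier_mat k c" "V \<in> carrier_mat c n" "A = U * V"
proof -
  obtain c F E where F: "F \<in> carrier_mat c k" and E: "E \<in> carrier_mat n c"
    and FAE: "F * A * E = 1\<^sub>m c" "A * E * F * A = A"
    by (rule generalized_inverse_exists[OF A])
  show thesis
  proof (rule that[of c "A * E" "F * A"])
    show "rank_at_least c A" unfolding rank_at_least_def using A F E FAE(1) by auto
    show "A = (A * E) * (F * A)"
      using A F E by (subst FAE(2)[symmetric]) (simp add: assoc_mult_mat_dim)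
  qed (use A F E in auto)
qed

lemma rank_at_least_le_cols:
  fixes A :: "'a::field mat"
  assumes "A \<in> carrier_mat k n" "rank_at_least c A"
  shows "c \<le> n"
  using rank_at_least_factor_le[OF assms(2), of A "1\<^sub>m n" k n n] assms(1) by auto

text \<open>The columns of \<open>P\<close> are columns of \<open>A\<close> that form a basis of the column space. This ties the dimension
  of the column space to the certificates.\<close>

lemma column_basis:
  fixes A :: "'a::field mat"
  assumes A: "A \<in> carrier_mat k n"
  obtains P Q V where "P \<in> carrier_mat k (vec_space.rank k A)" "Q \<in> carrier_mat (vec_space.rank k A) n"
    "V \<in> carrier_mat n (vec_space.rank k A)" "A = P * Q" "P = A * V"
    "\<forall>v \<in> carrier_vec (vec_space.rank k A). P *\<^sub>v v = 0\<^sub>v k \<longrightarrow> v = 0\<^sub>v (vec_space.rank k A)"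
proof -
  interpret vec_space "TYPE('a)" k .
  have fin: "finite (set (cols A))" and sub: "set (cols A) \<subseteq> carrier_vec k"
    using A cols_dim by blast+
  have indpt_empty: "lin_indpt {}" by (rule finite_lin_indpt2) auto
  obtain S where "finite S" and S: "maximal S (\<lambda>T. T \<subseteq> set (cols A) \<and> lin_indpt T)"
    using maximal_exists_superset[OF fin, of "\<lambda>T. T \<subseteq> set (cols A) \<and> lin_indpt T" "{}"] indpt_empty
    by blast
  have card: "rank A = card S" by (rule rank_card_indpt[OF A S])
  have Ssub: "S \<subseteq> set (cols A)" and Sli: "lin_indpt S" using S by (auto simp: maximal_def)
  have Sc: "S \<subseteq> carrier_vec k" using Ssub sub by blast
  have in_span: "x \<in> span S" if "x \<in> set (cols A)" for x
  proof (rule ccontr)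
    assume "x \<notin> span S"
    have x: "x \<in> carrier_vec k" using that sub by blast
    have "x \<notin> S" using \<open>x \<notin> span S\<close> span_mem[OF Sc] by blast
    then have "lin_indpt (insert x S)"
      using lin_dep_iff_in_span[OF Sc Sli x] \<open>x \<notin> span S\<close> by simp
    then have "insert x S = S" using S that Ssub unfolding maximal_def by blast
    then show False using \<open>x \<notin> S\<close> by blast
  qed
  obtain xs where xs: "set xs = S" "distinct xs"
    using \<open>finite S\<close> finite_distinct_list by blast
  define r where "r = length xs"
  have r: "r = rank A" using distinct_card[OF xs(2)] xs card by (simp add: r_def)
  define P where "P = mat_of_cols k xs"
  have P: "P \<in> carrier_mat k r" by (simp add: P_def r_def)
  have cP: "cols P = xs" using xs Sc by (simp add: P_def)
  have "\<exists>v \<in> carrier_vec r. P *\<^sub>v v = x" if x: "x \<in> set (cols A)" for x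
  proof -
    obtain a where "x = lincomb a S"
      using in_span[OF x] finite_span[OF \<open>finite S\<close> Sc] by auto
    then have "P *\<^sub>v vec r (\<lambda>i. a (col P i)) = x"
      using mat_mult_eq_lincomb[OF P] cP xs by simp
    then show ?thesis by (intro bexI[of _ "vec r (\<lambda>i. a (col P i))"]) auto
  qed
  then obtain v where v: "\<And>x. x \<in> set (cols A) \<Longrightarrow> v x \<in> carrier_vec r \<and> P *\<^sub>v v x = x" by metis
  define Q where "Q = mat_of_cols r (map v (cols A))"
  have Q: "Q \<in> carrier_mat r n" using A by (intro carrier_matI) (simp_all add: Q_def)
  have AQ: "A = P * Q"
  proof (rule mat_col_eqI)
    fix j assume "j < dim_col (P * Q)"
    then have j: "j < n" using Q by simp
    then have cj: "col A j \<in> set (cols A)" using A by (auto simp: cols_def)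
    have "col Q j = v (col A j)"
      using j A v[OF cj] by (simp add: Q_def)
    then show "col A j = col (P * Q) j"
      using v[OF cj] by (simp only: col_mult2[OF P Q j])
  qed (use A P Q in auto)
  have inj: "v = 0\<^sub>v r" if "v \<in> carrier_vec r" "P *\<^sub>v v = 0\<^sub>v k" for v
    using lin_depI[OF P that(1) _ that(2)] cP xs Sli by auto
  have "\<exists>j<n. x = col A j" if "x \<in> S" for x
    using subsetD[OF Ssub that] A by (auto simp: cols_def)
  then obtain h where h: "\<And>x. x \<in> S \<Longrightarrow> h x < n \<and> x = col A (h x)" by metis
  define V :: "'a mat" where "V = mat_of_cols n (map (\<lambda>x. unit_vec n (h x)) xs)"
  have V: "V \<in> carrier_mat n r" by (intro carrier_matI) (simp_all add: V_def r_def)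
  have PV: "P = A * V"
  proof (rule mat_col_eqI)
    fix j assume "j < dim_col (A * V)"
    then have j: "j < r" using V by simp
    then have xj: "xs ! j \<in> S" using xs by (auto simp: r_def)
    have "col V j = unit_vec n (h (xs ! j))"
      using j by (simp add: V_def r_def)
    moreover have "A *\<^sub>v unit_vec n l = col A l" if "l < n" for l
      using that A by (intro eq_vecI) auto
    ultimately have "col (A * V) j = col A (h (xs ! j))"
      using conjunct1[OF h[OF xj]] j by (simp add: col_mult2[OF A V])
    moreover have "col P j = xs ! j"
      using j Sc xj by (auto simp: P_def r_def)
    ultimately show "col P j = col (A * V) j"
      using conjunct2[OF h[OF xj], symmetric] by simp
  qed (use A P V in auto)
  show thesis
    by (rule that[OF P[unfolded r] Q[unfolded r] V[unfolded r] AQ PV]) (use inj[unfolded r] in blast)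
qed

lemma rank_at_least_le_rank:
  fixes A :: "'a::field mat"
  assumes "rank_at_least c A"
  shows "c \<le> vec_space.rank (dim_row A) A"
proof -
  have A: "A \<in> carrier_mat (dim_row A) (dim_col A)" by auto
  show ?thesis
  proof (rule column_basis[OF A])
    fix P Q V assume P: "P \<in> carrier_mat (dim_row A) (vec_space.rank (dim_row A) A)"
      and Q: "Q \<in> carrier_mat (vec_space.rank (dim_row A) A) (dim_col A)" and "A = P * Q"
    then show ?thesis by (intro rank_at_least_factor_le[OF assms _ P Q])
  qed
qed

lemma rank_at_least_rank:
  fixes A :: "'a::field mat"
  shows "rank_at_least (vec_space.rank (dim_row A) A) A"
proof -
  define k n where "k = dim_row A" and "n = dim_col A"
  have A: "A \<in> carrier_mat k n" unfolding k_def n_def by auto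
  define r where "r = vec_space.rank k A"
  obtain P Q V where P: "P \<in> carrier_mat k r" and "Q \<in> carrier_mat r n" and V: "V \<in> carrier_mat n r"
    and "A = P * Q" and PV: "P = A * V"
    and inj: "\<forall>v \<in> carrier_vec r. P *\<^sub>v v = 0\<^sub>v k \<longrightarrow> v = 0\<^sub>v r"
    unfolding r_def by (rule column_basis[OF A])
  obtain c F E where F: "F \<in> carrier_mat c k" and E: "E \<in> carrier_mat r c"
    and FPE: "F * P * E = 1\<^sub>m c" "P * E * F * P = P"
    using generalized_inverse_exists[OF P] by metis
  note [simp] = carrier_matD[OF A] carrier_matD[OF P] carrier_matD[OF V] carrier_matD[OF F] carrier_matD[OF E]
  define R where "R = 1\<^sub>m r - E * F * P"
  have R: "R \<in> carrier_mat r r" by (rule carrier_matI) (simp_all add: R_def)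
  have PR: "P * R = 0\<^sub>m k r"
  proof -
    have "P * R = P - P * E * F * P" by (simp add: R_def mat_dim_simps)
    then show ?thesis by (simp add: FPE minus_self_mat)
  qed
  have "col R j = 0\<^sub>v r" if "j < r" for j
  proof (rule inj[rule_format])
    have "col (P * R) j = P *\<^sub>v col R j" using that R by (simp add: col_mult2[OF P R])
    then show "P *\<^sub>v col R j = 0\<^sub>v k" using PR that by (simp add: col_zero)
  qed (use R in auto)
  then have R0: "R $$ (i, j) = 0" if "i < r" "j < r" for i j
    using that R by (metis index_col index_zero_vec(1) carrier_matD)
  have "E * F * P = 1\<^sub>m r"
  proof (rule eq_matI)
    fix i j assume "i < dim_row (1\<^sub>m r)" "j < dim_col (1\<^sub>m r)"
    then show "(E * F * P) $$ (i, j) = 1\<^sub>m r $$ (i, j)"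
      using R0[of i j] unfolding R_def by (simp del: index_mult_mat(1) index_one_mat(1))
  qed auto
  then have "(E * F) * A * V = 1\<^sub>m r" by (simp add: PV assoc_mult_mat_dim)
  then have "rank_at_least r A"
    unfolding rank_at_least_def by (intro bexI[of _ "E * F"] bexI[of _ V]) (auto intro!: carrier_matI)
  then show ?thesis unfolding r_def k_def .
qed

text \<open>Multilinearity of the determinant in the rows of \<open>F B\<close> (half of the Cauchy-Binet formula).\<close>

lemma det_nonzero_imp_row_selection:
  fixes B :: "'a::idom mat"
  assumes F: "F \<in> carrier_mat c k" and B: "B \<in> carrier_mat k c" and det: "det (F * B) \<noteq> 0"
  obtains f where "\<And>x. x < c \<Longrightarrow> f x < k" "det (mat c c (\<lambda>(x, y). B $$ (f x, y))) \<noteq> 0"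
proof -
  have "F * B = mat\<^sub>r c c (\<lambda>i. finsum_vec TYPE('a) c (\<lambda>l. F $$ (i, l) \<cdot>\<^sub>v row B l) {0..<k})"
    by (rule mat_mul_finsum_alt[OF F B])
  then have "det (F * B) = (\<Sum>f\<in>{f. (\<forall>i\<in>{0..<c}. f i \<in> {0..<k}) \<and> (\<forall>i. i \<notin> {0..<c} \<longrightarrow> f i = i)}.
      det (mat\<^sub>r c c (\<lambda>i. F $$ (i, f i) \<cdot>\<^sub>v row B (f i))))"
    using B by (simp add: det_linear_rows_sum)
  with det have "(\<Sum>f\<in>{f. (\<forall>i\<in>{0..<c}. f i \<in> {0..<k}) \<and> (\<forall>i. i \<notin> {0..<c} \<longrightarrow> f i = i)}.
      det (mat\<^sub>r c c (\<lambda>i. F $$ (i, f i) \<cdot>\<^sub>v row B (f i)))) \<noteq> 0" by simp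
  from sum.not_neutral_contains_not_neutral[OF this]
  obtain f where f: "\<forall>i\<in>{0..<c}. f i \<in> {0..<k}"
    and nz: "det (mat\<^sub>r c c (\<lambda>i. F $$ (i, f i) \<cdot>\<^sub>v row B (f i))) \<noteq> 0"
    by blast
  have "det (mat\<^sub>r c c (\<lambda>i. F $$ (i, f i) \<cdot>\<^sub>v row B (f i)))
      = (\<Prod>i = 0..<c. F $$ (i, f i)) * det (mat\<^sub>r c c (\<lambda>i. row B (f i)))"
    by (rule det_rows_mul) (use B f in auto)
  also have "mat\<^sub>r c c (\<lambda>i. row B (f i)) = mat c c (\<lambda>(x, y). B $$ (f x, y))"
    using B f by (intro eq_matI) auto
  finally have "det (mat c c (\<lambda>(x, y). B $$ (f x, y))) \<noteq> 0" using nz by auto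
  then show thesis using f by (intro that[of f]) auto
qed

lemma rank_at_least_imp_minor:
  fixes A :: "'a::field mat"
  assumes A: "A \<in> carrier_mat k n" and "rank_at_least c A"
  obtains f g where "\<And>x. x < c \<Longrightarrow> f x < k" "\<And>x. x < c \<Longrightarrow> g x < n"
    "det (mat c c (\<lambda>(x, y). A $$ (f x, g y))) \<noteq> 0"
proof -
  obtain F E where F: "F \<in> carrier_mat c k" and E: "E \<in> carrier_mat n c" and FAE: "F * A * E = 1\<^sub>m c"
    using assms unfolding rank_at_least_def by auto
  have "F * (A * E) = 1\<^sub>m c" using FAE A F E by (simp add: assoc_mult_mat_dim)
  then obtain f where f: "\<And>x. x < c \<Longrightarrow> f x < k"
    and df: "det (mat c c (\<lambda>(x, y). (A * E) $$ (f x, y))) \<noteq> 0"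
    using det_nonzero_imp_row_selection[OF F, of "A * E"] A E by auto
  define A' where "A' = mat c n (\<lambda>(x, q). A $$ (f x, q))"
  have A': "A' \<in> carrier_mat c n" by (simp add: A'_def)
  have "mat c c (\<lambda>(x, y). (A * E) $$ (f x, y)) = A' * E"
    using A E f by (intro eq_matI) (auto simp: A'_def scalar_prod_def)
  then have "det (A' * E) \<noteq> 0" using df by simp
  moreover have "det (transpose_mat E * transpose_mat A') = det (A' * E)"
    using A' E by (metis det_transpose mult_carrier_mat transpose_mult)
  ultimately obtain g where g: "\<And>x. x < c \<Longrightarrow> g x < n"
    and dg: "det (mat c c (\<lambda>(x, y). transpose_mat A' $$ (g x, y))) \<noteq> 0"
    using det_nonzero_imp_row_selection[of "transpose_mat E" c n "transpose_mat A'"] A' E by auto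
  have "mat c c (\<lambda>(x, y). transpose_mat A' $$ (g x, y)) = transpose_mat (mat c c (\<lambda>(x, y). A $$ (f x, g y)))"
    using g by (intro eq_matI) (auto simp: A'_def)
  then have "det (mat c c (\<lambda>(x, y). A $$ (f x, g y))) \<noteq> 0"
    using dg det_transpose[of "mat c c (\<lambda>(x, y). A $$ (f x, g y))" c] by simp
  with f g show thesis by (rule that)
qed

text \<open>If \<open>r = c\<close>, a minor of \<open>P Q\<close> is a minor of \<open>P\<close> times a minor of \<open>Q\<close>. If \<open>r < c\<close>, all these minors
  vanish.\<close>

lemma minors_rank_one:
  fixes P :: "'a::idom mat"
  assumes P: "P \<in> carrier_mat k r" and Q: "Q \<in> carrier_mat r n" and "r \<le> c"
    and f: "\<And>x. x < c \<Longrightarrow> f x < k" "\<And>x. x < c \<Longrightarrow> f' x < k"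
    and g: "\<And>x. x < c \<Longrightarrow> g x < n" "\<And>x. x < c \<Longrightarrow> g' x < n"
  defines "m \<equiv> \<lambda>f g. det (mat c c (\<lambda>(x, y). (P * Q) $$ (f x, g y)))"
  shows "m f g * m f' g' = m f g' * m f' g"
proof -
  define p where "p f = mat c r (\<lambda>(x, l). P $$ (f x, l))" for f :: "nat \<Rightarrow> nat"
  define q where "q g = mat r c (\<lambda>(l, y). Q $$ (l, g y))" for g :: "nat \<Rightarrow> nat"
  have pq: "p f \<in> carrier_mat c r" "q g \<in> carrier_mat r c" for f g
    by (auto simp: p_def q_def)
  have m: "m f g = det (p f * q g)" if "\<And>x. x < c \<Longrightarrow> f x < k" "\<And>x. x < c \<Longrightarrow> g x < n" for f g
    unfolding m_def using that P Q
    by (intro arg_cong[of _ _ det] eq_matI) (auto simp: p_def q_def scalar_prod_def)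
  show ?thesis
  proof (cases "r = c")
    case True
    then have "det (p f * q g) = det (p f) * det (q g)" for f g
      using pq(1)[of f] pq(2)[of g] by (intro det_mult) auto
    then show ?thesis using f g by (simp add: m)
  next
    case False
    then have "det (p f * q g) = 0" for f g
      using pq(1)[of f] pq(2)[of g] \<open>r \<le> c\<close> by (intro det_factor_through_smaller) auto
    then show ?thesis using f g by (simp add: m)
  qed
qed

lemma minor_imp_rank_at_least:
  fixes A :: "'a::field mat"
  assumes A: "A \<in> carrier_mat k n"
    and f: "\<And>x. x < c \<Longrightarrow> f x < k" and g: "\<And>x. x < c \<Longrightarrow> g x < n"
    and nz: "det (mat c c (\<lambda>(x, y). A $$ (f x, g y))) \<noteq> 0"
  shows "rank_at_least c A"
proof -
  define F where "F = mat c k (\<lambda>(x, p). if p = f x then 1 else (0::'a))"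
  define E where "E = mat n c (\<lambda>(q, y). if q = g y then 1 else (0::'a))"
  have F: "F \<in> carrier_mat c k" and E: "E \<in> carrier_mat n c" by (auto simp: F_def E_def)
  have "F * (A * E) = mat c c (\<lambda>(x, y). A $$ (f x, g y))"
  proof (rule eq_matI)
    fix x y assume "x < dim_row (mat c c (\<lambda>(x, y). A $$ (f x, g y)))" "y < dim_col (mat c c (\<lambda>(x, y). A $$ (f x, g y)))"
    then have xy: "x < c" "y < c" by auto
    have rF: "row F x = unit_vec k (f x)" and cE: "col E y = unit_vec n (g y)"
      using xy f g by (auto simp: F_def E_def unit_vec_def)
    have "A *\<^sub>v unit_vec n (g y) = col A (g y)"
      using A g[OF xy(2)] by (intro eq_vecI) auto
    then have "(F * (A * E)) $$ (x, y) = unit_vec k (f x) \<bullet> col A (g y)"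
      using mult_mat_mult_index[of x F y E A] xy F A E rF cE by simp
    also have "\<dots> = A $$ (f x, g y)"
      using A f[OF xy(1)] g[OF xy(2)] by (simp add: scalar_prod_left_unit)
    finally show "(F * (A * E)) $$ (x, y) = mat c c (\<lambda>(x, y). A $$ (f x, g y)) $$ (x, y)"
      using xy by simp
  qed (use F E in auto)
  then have "F * A * E = mat c c (\<lambda>(x, y). A $$ (f x, g y))"
    using F A E by (simp add: assoc_mult_mat_dim)
  then show ?thesis using nz by (intro rank_at_leastI_det[OF A F E]) simp
qed

lemma rank_sum_le:
  fixes P1 :: "'a::field mat"
  assumes "rank_at_least c (P1 * Q1 + P2 * Q2)"
    and P: "P1 \<in> carrier_mat k a" "P2 \<in> carrier_mat k b" and Q: "Q1 \<in> carrier_mat a n" "Q2 \<in> carrier_mat b n"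
  shows "c \<le> a + b"
proof -
  define P where "P = mat k (a + b) (\<lambda>(i, l). if l < a then P1 $$ (i, l) else P2 $$ (i, l - a))"
  define Q where "Q = mat (a + b) n (\<lambda>(l, j). if l < a then Q1 $$ (l, j) else Q2 $$ (l - a, j))"
  have "P1 * Q1 + P2 * Q2 = P * Q"
  proof (rule eq_matI)
    fix i j assume "i < dim_row (P * Q)" "j < dim_col (P * Q)"
    then have ij: "i < k" "j < n" by (auto simp: P_def Q_def)
    have "(P * Q) $$ (i, j) = (\<Sum>l = 0..<a + b. P $$ (i, l) * Q $$ (l, j))"
      using ij by (simp add: P_def Q_def scalar_prod_def)
    also have "\<dots> = (\<Sum>l = 0..<a. P $$ (i, l) * Q $$ (l, j)) + (\<Sum>l = 0..<b. P $$ (i, a + l) * Q $$ (a + l, j))"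
      using sum.atLeastLessThan_concat[of 0 a "a + b" "\<lambda>l. P $$ (i, l) * Q $$ (l, j)"]
        sum.shift_bounds_nat_ivl[of "\<lambda>l. P $$ (i, l) * Q $$ (l, j)" 0 a b]
      by (simp add: add.commute)
    also have "\<dots> = (P1 * Q1 + P2 * Q2) $$ (i, j)"
      using ij assms by (simp add: P_def Q_def scalar_prod_def)
    finally show "(P1 * Q1 + P2 * Q2) $$ (i, j) = (P * Q) $$ (i, j)" by simp
  qed (use assms in \<open>auto simp: P_def Q_def\<close>)
  then show ?thesis
    using assms(1) by (intro rank_at_least_factor_le[of c _ P Q k "a + b" n]) (auto simp: P_def Q_def)
qed

text \<open>Stack a certificate for \<open>C\<close> on a certificate for \<open>B\<close>: the \<open>(c + b) \<times> r\<close> matrix with blocks \<open>F1 C\<close>, \<open>F2\<close>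
  times the \<open>r \<times> (c + b)\<close> matrix with blocks \<open>E1\<close>, \<open>B E2\<close> is unitriangular, because \<open>C B = 0\<close>.\<close>

lemma rank_product_zero:
  fixes C :: "'a::field mat"
  assumes C: "C \<in> carrier_mat k r" and B: "B \<in> carrier_mat r n" and CB: "C * B = 0\<^sub>m k n"
    and "rank_at_least c C" "rank_at_least b B"
  shows "c + b \<le> r"
proof (rule ccontr)
  assume "\<not> c + b \<le> r"
  obtain F1 E1 where F1: "F1 \<in> carrier_mat c k" and E1: "E1 \<in> carrier_mat r c" and 1: "F1 * C * E1 = 1\<^sub>m c"
    using assms unfolding rank_at_least_def by auto
  obtain F2 E2 where F2: "F2 \<in> carrier_mat b r" and E2: "E2 \<in> carrier_mat n b" and 2: "F2 * B * E2 = 1\<^sub>m b"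
    using assms unfolding rank_at_least_def by auto
  note [simp] = carrier_matD[OF C] carrier_matD[OF B] carrier_matD[OF F1] carrier_matD[OF E1]
    carrier_matD[OF F2] carrier_matD[OF E2]
  have blocks: "F1 * C * (B * E2) = 0\<^sub>m c b" "F2 * (B * E2) = 1\<^sub>m b"
  proof -
    have "F1 * C * (B * E2) = F1 * (C * B * E2)" by (simp add: assoc_mult_mat_dim)
    then show "F1 * C * (B * E2) = 0\<^sub>m c b" by (simp add: CB)
    show "F2 * (B * E2) = 1\<^sub>m b" using 2 by (simp add: assoc_mult_mat_dim)
  qed
  define U where "U = mat (c + b) r (\<lambda>(i, l). if i < c then (F1 * C) $$ (i, l) else F2 $$ (i - c, l))"
  define V where "V = mat r (c + b) (\<lambda>(l, j). if j < c then E1 $$ (l, j) else (B * E2) $$ (l, j - c))"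
  have row: "row U i = (if i < c then row (F1 * C) i else row F2 (i - c))" if "i < c + b" for i
    using that by (intro eq_vecI) (auto simp: U_def)
  have col: "col V j = (if j < c then col E1 j else col (B * E2) (j - c))" if "j < c + b" for j
    using that by (intro eq_vecI) (auto simp: V_def)
  have "U * V = four_block_mat (1\<^sub>m c) (0\<^sub>m c b) (F2 * E1) (1\<^sub>m b)" (is "_ = ?R")
  proof (rule eq_matI)
    fix i j assume "i < dim_row ?R" "j < dim_col ?R"
    then have ij: "i < c + b" "j < c + b" by auto
    have "(U * V) $$ (i, j) = row U i \<bullet> col V j"
      using ij by (simp add: U_def V_def)
    also have "\<dots> = (if i < c then if j < c then (F1 * C * E1) $$ (i, j) else (F1 * C * (B * E2)) $$ (i, j - c)
        else if j < c then (F2 * E1) $$ (i - c, j) else (F2 * (B * E2)) $$ (i - c, j - c))"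
      unfolding row[OF ij(1)] col[OF ij(2)] using ij by auto
    also have "\<dots> = ?R $$ (i, j)"
      unfolding 1 blocks using ij by (auto simp del: index_mult_mat(1))
    finally show "(U * V) $$ (i, j) = ?R $$ (i, j)" .
  qed (auto simp: U_def V_def)
  moreover have "det (four_block_mat (1\<^sub>m c) (0\<^sub>m c b) (F2 * E1) (1\<^sub>m b)) = det (1\<^sub>m c :: 'a mat) * det (1\<^sub>m b :: 'a mat)"
    by (rule det_four_block_mat_upper_right_zero) (auto intro!: carrier_matI)
  moreover have "det (U * V) = 0"
    using \<open>\<not> c + b \<le> r\<close> by (intro det_factor_through_smaller[of U "c + b" r]) (auto simp: U_def V_def)
  ultimately show False by simp
qed

lemma max_rank_rank_at_least:
  fixes S :: "'a::field mat set"
  assumes "S \<subseteq> carrier_mat r c" "S \<noteq> {}"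
  shows "\<exists>A\<in>S. rank_at_least (max_rank S) A"
    and "\<And>A q. A \<in> S \<Longrightarrow> rank_at_least q A \<Longrightarrow> q \<le> max_rank S"
proof -
  have fin: "finite ((\<lambda>A. vec_space.rank (dim_row A) A) ` S)" by (rule finite_ranks[OF assms(1)])
  then have "max_rank S \<in> (\<lambda>A. vec_space.rank (dim_row A) A) ` S"
    unfolding max_rank_def using assms(2) by (intro Max_in) auto
  then obtain A where "A \<in> S" "max_rank S = vec_space.rank (dim_row A) A" by blast
  then show "\<exists>A\<in>S. rank_at_least (max_rank S) A" using rank_at_least_rank[of A] by auto
  fix A q assume A: "A \<in> S" "rank_at_least q A"
  have "q \<le> vec_space.rank (dim_row A) A" by (rule rank_at_least_le_rank[OF A(2)])
  also have "\<dots> \<le> max_rank S" unfolding max_rank_def using A by (intro Max_ge[OF fin]) auto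
  finally show "q \<le> max_rank S" .
qed

section \<open>Generic points over an infinite field\<close>

definition poly_fun :: "('a::comm_ring_1 \<Rightarrow> 'a) \<Rightarrow> bool" where
  "poly_fun f \<longleftrightarrow> (\<exists>p. \<forall>t. f t = poly p t)"

lemma poly_fun_const: "poly_fun (\<lambda>_. c)"
  unfolding poly_fun_def by (intro exI[of _ "[:c:]"]) simp

lemma poly_fun_id: "poly_fun (\<lambda>t. t)"
  unfolding poly_fun_def by (intro exI[of _ "[:0, 1:]"]) simp

lemma poly_fun_add: "poly_fun f \<Longrightarrow> poly_fun g \<Longrightarrow> poly_fun (\<lambda>t. f t + g t)"
  unfolding poly_fun_def by (metis poly_add)

lemma poly_fun_mult: "poly_fun f \<Longrightarrow> poly_fun g \<Longrightarrow> poly_fun (\<lambda>t. f t * g t)"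
  unfolding poly_fun_def by (metis poly_mult)

lemma poly_fun_diff: "poly_fun f \<Longrightarrow> poly_fun g \<Longrightarrow> poly_fun (\<lambda>t. f t - g t)"
  unfolding poly_fun_def by (metis poly_diff)

lemma sum_closed:
  assumes "P (\<lambda>_. 0)" "\<And>f g. P f \<Longrightarrow> P g \<Longrightarrow> P (\<lambda>t. f t + g t)" "\<And>x. x \<in> S \<Longrightarrow> P (\<lambda>t. g x t)"
  shows "P (\<lambda>t. \<Sum>x\<in>S. g x t :: 'r::comm_monoid_add)"
  using assms(3)
proof (induction S rule: infinite_finite_induct)
  case (insert x S)
  then show ?case using assms(2)[of "g x" "\<lambda>t. \<Sum>x\<in>S. g x t"] by simp
qed (use assms(1) in auto)

lemma prod_closed:
  assumes "P (\<lambda>_. 1)" "\<And>f g. P f \<Longrightarrow> P g \<Longrightarrow> P (\<lambda>t. f t * g t)" "\<And>x. x \<in> S \<Longrightarrow> P (\<lambda>t. g x t)"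
  shows "P (\<lambda>t. \<Prod>x\<in>S. g x t :: 'r::comm_monoid_mult)"
  using assms(3)
proof (induction S rule: infinite_finite_induct)
  case (insert x S)
  then show ?case using assms(2)[of "g x" "\<lambda>t. \<Prod>x\<in>S. g x t"] by simp
qed (use assms(1) in auto)

lemma det_closed:
  fixes A :: "'t \<Rightarrow> 'r::comm_ring_1 mat"
  assumes const: "\<And>c. P (\<lambda>_. c)"
    and add: "\<And>f g. P f \<Longrightarrow> P g \<Longrightarrow> P (\<lambda>t. f t + g t)"
    and mult: "\<And>f g. P f \<Longrightarrow> P g \<Longrightarrow> P (\<lambda>t. f t * g t)"
    and A: "\<And>t. A t \<in> carrier_mat n n"
    and entries: "\<And>i j. i < n \<Longrightarrow> j < n \<Longrightarrow> P (\<lambda>t. A t $$ (i, j))"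
  shows "P (\<lambda>t. det (A t))"
proof -
  have "P (\<lambda>t. signof p * (\<Prod>i = 0..<n. A t $$ (i, p i)))" if "p permutes {0..<n}" for p
  proof (intro mult const prod_closed[where P = P])
    fix i assume "i \<in> {0..<n}"
    then show "P (\<lambda>t. A t $$ (i, p i))"
      using permutes_in_image[OF that, of i] by (intro entries) auto
  qed
  then have "P (\<lambda>t. \<Sum>p\<in>{p. p permutes {0..<n}}. signof p * (\<Prod>i = 0..<n. A t $$ (i, p i)))"
    by (intro sum_closed[where P = P] const add) auto
  then show ?thesis using A by (simp add: det_def'[of _ n])
qed

definition poly_mat :: "nat \<Rightarrow> nat \<Rightarrow> ('a::comm_ring_1 \<Rightarrow> 'a mat) \<Rightarrow> bool" where
  "poly_mat k n A \<longleftrightarrow> (\<forall>t. A t \<in> carrier_mat k n) \<and> (\<forall>i<k. \<forall>j<n. poly_fun (\<lambda>t. A t $$ (i, j)))"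

lemma poly_mat_const: "A \<in> carrier_mat k n \<Longrightarrow> poly_mat k n (\<lambda>_. A)"
  by (auto simp: poly_mat_def poly_fun_const)

lemma poly_mat_dim:
  assumes "poly_mat k n A"
  shows "dim_row (A t) = k" "dim_col (A t) = n"
  using assms unfolding poly_mat_def by (meson carrier_matD)+

lemma poly_mat_add:
  assumes "poly_mat k n A" "poly_mat k n B"
  shows "poly_mat k n (\<lambda>t. A t + B t)"
  using assms unfolding poly_mat_def
  by (auto simp: poly_mat_dim[OF assms(1)] poly_mat_dim[OF assms(2)] intro!: poly_fun_add)

lemma poly_mat_smult:
  assumes "poly_fun f" "poly_mat k n A"
  shows "poly_mat k n (\<lambda>t. f t \<cdot>\<^sub>m A t)"
  using assms unfolding poly_mat_def
  by (auto simp: poly_mat_dim[OF assms(2)] intro!: poly_fun_mult)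

lemma poly_mat_mult:
  assumes "poly_mat k m A" "poly_mat m n B"
  shows "poly_mat k n (\<lambda>t. A t * B t)"
proof -
  have A: "A t \<in> carrier_mat k m" and B: "B t \<in> carrier_mat m n" for t
    using assms unfolding poly_mat_def by blast+
  have dims: "dim_row (A t) = k" "dim_col (A t) = m" "dim_row (B t) = m" "dim_col (B t) = n" for t
    using A[of t] B[of t] by auto
  have "poly_fun (\<lambda>t. (A t * B t) $$ (i, j))" if "i < k" "j < n" for i j
  proof -
    have "poly_fun (\<lambda>t. \<Sum>l\<in>{0..<m}. A t $$ (i, l) * B t $$ (l, j))"
      using assms that unfolding poly_mat_def
      by (intro sum_closed[where P = poly_fun] poly_fun_const poly_fun_add poly_fun_mult) auto
    then show ?thesis using that by (simp add: dims scalar_prod_def)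
  qed
  then show ?thesis unfolding poly_mat_def using mult_carrier_mat[OF A B] by blast
qed

lemma poly_fun_det: "poly_mat n n A \<Longrightarrow> poly_fun (\<lambda>t. det (A t))"
  unfolding poly_mat_def
  by (rule det_closed[where P = poly_fun]) (auto intro: poly_fun_const poly_fun_add poly_fun_mult)

lemma poly_mat_adj:
  assumes "poly_mat n n A"
  shows "poly_mat n n (\<lambda>t. adj_mat (A t))"
proof -
  have dims: "dim_row (A t) = n" "dim_col (A t) = n" for t
    using assms unfolding poly_mat_def by (meson carrier_matD)+
  have "poly_fun (\<lambda>t. adj_mat (A t) $$ (i, j))" if ij: "i < n" "j < n" for i j
  proof -
    have "poly_mat (n - 1) (n - 1) (\<lambda>t. mat_delete (A t) j i)"
      using assms ij unfolding poly_mat_def mat_delete_def by (auto simp: dims)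
    then show ?thesis
      using ij by (simp add: adj_mat_def cofactor_def dims poly_fun_mult poly_fun_const poly_fun_det)
  qed
  then show ?thesis using assms adj_mat(1) unfolding poly_mat_def by blast
qed

lemma poly_fun_eqI:
  fixes f g :: "'a::idom \<Rightarrow> 'a"
  assumes inf: "infinite (UNIV :: 'a set)" and "poly_fun f" "poly_fun g"
    and h: "poly_fun h" "h a \<noteq> 0" and eq: "\<And>t. h t \<noteq> 0 \<Longrightarrow> f t = g t"
  shows "f = g"
proof -
  obtain p q r where pqr: "\<And>t. f t = poly p t" "\<And>t. g t = poly q t" "\<And>t. h t = poly r t"
    using assms unfolding poly_fun_def by blast
  have "poly (r * (p - q)) t = 0" for t
    using eq[of t] by (auto simp: pqr)
  then have "r * (p - q) = 0"
    using poly_roots_finite[of "r * (p - q)"] inf by auto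
  moreover have "r \<noteq> 0" using h by (auto simp: pqr)
  ultimately show ?thesis by (intro ext) (simp add: pqr)
qed

definition mat_line :: "'a::comm_ring_1 mat \<Rightarrow> 'a mat \<Rightarrow> 'a \<Rightarrow> 'a mat" where
  "mat_line M N t = (1 - t) \<cdot>\<^sub>m M + t \<cdot>\<^sub>m N"

lemma poly_mat_line: "M \<in> carrier_mat k n \<Longrightarrow> N \<in> carrier_mat k n \<Longrightarrow> poly_mat k n (mat_line M N)"
  unfolding mat_line_def
  by (intro poly_mat_add poly_mat_smult poly_mat_const poly_fun_diff poly_fun_const poly_fun_id)

text \<open>Nonvanishing conditions that are polynomial along lines can be met simultaneously: join a point that
  satisfies all but one of them to a point that satisfies the last one. On the line, each condition
  excludes finitely many points. This avoids polynomials in several variables.\<close>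

lemma generic_point:
  fixes Y :: "'a::idom mat set"
  assumes inf: "infinite (UNIV :: 'a set)"
    and Y: "Y \<subseteq> carrier_mat k n" "Y \<noteq> {}" "\<And>M N t. M \<in> Y \<Longrightarrow> N \<in> Y \<Longrightarrow> mat_line M N t \<in> Y"
    and "finite I"
    and poly: "\<And>i M N. i \<in> I \<Longrightarrow> M \<in> Y \<Longrightarrow> N \<in> Y \<Longrightarrow> poly_fun (\<lambda>t. \<phi> i (mat_line M N t))"
    and nonzero: "\<And>i. i \<in> I \<Longrightarrow> \<exists>M\<in>Y. \<phi> i M \<noteq> 0"
  shows "\<exists>M\<in>Y. \<forall>i\<in>I. \<phi> i M \<noteq> 0"
  using \<open>finite I\<close> poly nonzero
proof (induction I rule: finite_induct)
  case empty
  then show ?case using Y by auto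
next
  case (insert x I)
  then obtain M where M: "M \<in> Y" "\<forall>i\<in>I. \<phi> i M \<noteq> 0" by auto
  obtain N where N: "N \<in> Y" "\<phi> x N \<noteq> 0" using insert.prems(2)[of x] by blast
  have ends: "mat_line M N 0 = M" "mat_line M N 1 = N"
    using subsetD[OF Y(1) M(1)] subsetD[OF Y(1) N(1)] by (auto simp: mat_line_def intro!: eq_matI)
  have "\<forall>i\<in>insert x I. \<exists>p. \<forall>t. \<phi> i (mat_line M N t) = poly p t"
    using insert.prems(1) M(1) N(1) unfolding poly_fun_def by blast
  then obtain p where p: "\<And>i t. i \<in> insert x I \<Longrightarrow> \<phi> i (mat_line M N t) = poly (p i) t" by metis
  have "poly (p i) 0 \<noteq> 0" if "i \<in> I" for i using p[of i 0] that M ends by auto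
  moreover have "poly (p x) 1 \<noteq> 0" using p[of x 1] N ends by auto
  ultimately have "\<forall>i\<in>insert x I. p i \<noteq> 0" by (metis insertE poly_0)
  then have "(\<Prod>i\<in>insert x I. p i) \<noteq> 0"
    using insert.hyps by (simp add: prod_zero_iff)
  then obtain t where "poly (\<Prod>i\<in>insert x I. p i) t \<noteq> 0"
    using poly_roots_finite inf by (metis (mono_tags, lifting) UNIV_eq_I mem_Collect_eq)
  then have "\<forall>i\<in>insert x I. poly (p i) t \<noteq> 0"
    using insert.hyps by (auto simp: poly_prod)
  then show ?case using p Y(3)[OF M(1) N(1)] by (intro bexI[of _ "mat_line M N t"]) auto
qed

section \<open>Blow-ups described by their slices\<close>

definition matrix_space :: "nat \<Rightarrow> nat \<Rightarrow> 'a::field mat set \<Rightarrow> bool" where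
  "matrix_space k n X \<longleftrightarrow> X \<subseteq> carrier_mat k n \<and> 0\<^sub>m k n \<in> X
     \<and> (\<forall>A\<in>X. \<forall>B\<in>X. A + B \<in> X) \<and> (\<forall>c. \<forall>A\<in>X. c \<cdot>\<^sub>m A \<in> X)"

lemma matrix_space_subspace:
  fixes X :: "'a::field mat set"
  assumes "subspace class_ring X (module_mat TYPE('a) k n)"
  shows "matrix_space k n X"
proof -
  have sub: "submodule class_ring X (module_mat TYPE('a) k n)"
    using assms unfolding subspace_def by simp
  from submodule.smult_closed[OF sub]
  have "c \<cdot>\<^sub>m A \<in> X" if "A \<in> X" for c A
    using that by (simp add: module_mat_simps class_ring_simps)
  with sub show ?thesis
    unfolding submodule_def matrix_space_def by (auto simp: module_mat_simps)
qed

text \<open>Position \<open>(a, b)\<close> of every \<open>d \<times> d\<close> block, i.e. the coefficient of the matrix unit \<open>E\<^sub>a\<^sub>b\<close> when the matrix is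
  written in the tensor product with the \<open>d \<times> d\<close> matrices.\<close>

definition slice :: "nat \<Rightarrow> nat \<Rightarrow> nat \<Rightarrow> nat \<Rightarrow> nat \<Rightarrow> 'a mat \<Rightarrow> 'a mat" where
  "slice k n d a b M = mat k n (\<lambda>(i, j). M $$ (i * d + a, j * d + b))"

definition blow_up :: "nat \<Rightarrow> nat \<Rightarrow> nat \<Rightarrow> 'a mat set \<Rightarrow> 'a mat set" where
  "blow_up k n d X = {M \<in> carrier_mat (k * d) (n * d). \<forall>a<d. \<forall>b<d. slice k n d a b M \<in> X}"

lemma block_index_less: "i < k \<Longrightarrow> a < d \<Longrightarrow> i * d + a < k * (d::nat)"
  using mult_le_mono1[of "Suc i" k d] by simp

lemma div_less_block: "p < k * d \<Longrightarrow> p div d < (k::nat)"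
  by (rule less_mult_imp_div_less)

lemma mod_less_block: "p < k * d \<Longrightarrow> p mod d < (d::nat)"
  by (cases "d = 0") auto

lemma eq_mat_slices:
  assumes M: "M \<in> carrier_mat (k * d) (n * d)" and N: "N \<in> carrier_mat (k * d) (n * d)"
    and eq: "\<And>a b. a < d \<Longrightarrow> b < d \<Longrightarrow> slice k n d a b M = slice k n d a b N"
  shows "M = N"
proof (rule eq_matI)
  fix p q assume "p < dim_row N" "q < dim_col N"
  then have p: "p < k * d" and q: "q < n * d" using N by auto
  have "slice k n d (p mod d) (q mod d) M $$ (p div d, q div d)
      = slice k n d (p mod d) (q mod d) N $$ (p div d, q div d)"
    using eq[of "p mod d" "q mod d"] mod_less_block[OF p] mod_less_block[OF q] by simp
  then show "M $$ (p, q) = N $$ (p, q)"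
    using div_less_block[OF p] div_less_block[OF q] by (simp add: slice_def)
qed (use M N in auto)

lemma slice_carrier [simp]: "slice k n d a b M \<in> carrier_mat k n"
  by (simp add: slice_def)

lemma slice_add:
  assumes "M \<in> carrier_mat (k * d) (n * d)" "N \<in> carrier_mat (k * d) (n * d)" "a < d" "b < d"
  shows "slice k n d a b (M + N) = slice k n d a b M + slice k n d a b N"
  using assms by (intro eq_matI) (auto simp: slice_def block_index_less)

lemma slice_smult:
  assumes "M \<in> carrier_mat (k * d) (n * d)" "a < d" "b < d"
  shows "slice k n d a b (c \<cdot>\<^sub>m M) = c \<cdot>\<^sub>m slice k n d a b M"
  using assms by (intro eq_matI) (auto simp: slice_def block_index_less)

lemma matrix_space_blow_up:
  assumes "matrix_space k n X"
  shows "matrix_space (k * d) (n * d) (blow_up k n d X)"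
proof -
  have "slice k n d a b (0\<^sub>m (k * d) (n * d)) = (0\<^sub>m k n :: 'a mat)" if "a < d" "b < d" for a b
    using that by (intro eq_matI) (auto simp: slice_def block_index_less)
  then show ?thesis
    using assms unfolding matrix_space_def blow_up_def by (auto simp: slice_add slice_smult)
qed

lemma finsum_module_mat_index:
  fixes A :: "nat \<Rightarrow> 'a::field mat"
  assumes "\<And>i. i < m \<Longrightarrow> A i \<in> carrier_mat r c"
  shows "(\<Oplus>\<^bsub>module_mat TYPE('a) r c\<^esub> i \<in> {..<m}. A i) \<in> carrier_mat r c \<and>
    (\<forall>p<r. \<forall>q<c. (\<Oplus>\<^bsub>module_mat TYPE('a) r c\<^esub> i \<in> {..<m}. A i) $$ (p, q) = (\<Sum>i<m. A i $$ (p, q)))"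
proof -
  let ?M = "module_mat TYPE('a) r c"
  interpret M: vectorspace class_ring ?M by (rule matrix_vs)
  show ?thesis using assms
  proof (induction m)
    case 0
    then show ?case by (simp add: M.finsum_empty) (simp add: module_mat_simps)
  next
    case (Suc m)
    have A: "A \<in> {..<m} \<rightarrow> carrier ?M" "A m \<in> carrier ?M" using Suc.prems by (auto simp: module_mat_simps)
    have "(\<Oplus>\<^bsub>?M\<^esub> i \<in> {..<Suc m}. A i) = A m \<oplus>\<^bsub>?M\<^esub> (\<Oplus>\<^bsub>?M\<^esub> i \<in> {..<m}. A i)"
      unfolding lessThan_Suc by (rule M.finsum_insert) (use A in auto)
    also have "\<dots> = A m + (\<Oplus>\<^bsub>?M\<^esub> i \<in> {..<m}. A i)" by (simp add: module_mat_simps)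
    finally show ?case using Suc by auto
  qed
qed

text \<open>For the inclusion from right to left, expand in the matrix units, enumerated as \<open>e = a d + b\<close>.\<close>

lemma tensor_blow_up_eq_blow_up:
  fixes X :: "'a::field mat set"
  assumes X: "matrix_space k n X"
  shows "tensor_blow_up k n d X = blow_up k n d X"
proof (intro equalityI subsetI)
  fix M assume "M \<in> tensor_blow_up k n d X"
  then obtain m :: nat and Z T where
    M: "M = (\<Oplus>\<^bsub>module_mat TYPE('a) (k * d) (n * d)\<^esub> i \<in> {..<m}. kronecker (Z i) (T i))"
    and Z: "\<forall>i<m. Z i \<in> X" and T: "\<forall>i<m. T i \<in> carrier_mat d d"
    unfolding tensor_blow_up_def by auto
  have Zc: "Z i \<in> carrier_mat k n" if "i < m" for i using that Z X by (auto simp: matrix_space_def)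
  have "kronecker (Z i) (T i) \<in> carrier_mat (k * d) (n * d)" if "i < m" for i
    using that Zc T by (intro kronecker_carrier) auto
  from finsum_module_mat_index[of m, OF this] M
  have Mc: "M \<in> carrier_mat (k * d) (n * d)"
    and Mi: "\<And>p q. p < k * d \<Longrightarrow> q < n * d \<Longrightarrow> M $$ (p, q) = (\<Sum>i<m. kronecker (Z i) (T i) $$ (p, q))"
    by auto
  have kr: "kronecker (Z i) (T i) $$ (i' * d + a, j' * d + b) = T i $$ (a, b) * Z i $$ (i', j')"
    if "i < m" "i' < k" "j' < n" "a < d" "b < d" for i i' j' a b
    using that Zc[of i] T block_index_less[of i' k a d] block_index_less[of j' n b d]
    by (auto simp: kronecker_def)
  have "slice k n d a b M \<in> X" if ab: "a < d" "b < d" for a b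
  proof -
    have part: "mat k n (\<lambda>(i', j'). \<Sum>i<l. T i $$ (a, b) * Z i $$ (i', j')) \<in> X" if "l \<le> m" for l
      using that
    proof (induction l)
      case 0
      have "mat k n (\<lambda>(i', j'). 0) = (0\<^sub>m k n :: 'a mat)" by (intro eq_matI) auto
      then show ?case using X by (simp add: matrix_space_def case_prod_unfold)
    next
      case (Suc l)
      have eq: "mat k n (\<lambda>(i', j'). \<Sum>i<Suc l. T i $$ (a, b) * Z i $$ (i', j'))
          = mat k n (\<lambda>(i', j'). \<Sum>i<l. T i $$ (a, b) * Z i $$ (i', j')) + T l $$ (a, b) \<cdot>\<^sub>m Z l"
        using Zc[of l] Suc.prems by (intro eq_matI) auto
      have "T l $$ (a, b) \<cdot>\<^sub>m Z l \<in> X"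
        using Z Suc.prems X by (simp add: matrix_space_def)
      then show ?case
        unfolding eq using Suc X unfolding matrix_space_def by (meson Suc_leD)
    qed
    have "slice k n d a b M = mat k n (\<lambda>(i', j'). \<Sum>i<m. T i $$ (a, b) * Z i $$ (i', j'))"
      using ab by (intro eq_matI) (auto simp: slice_def Mi block_index_less kr)
    then show ?thesis using part[of m] by simp
  qed
  then show "M \<in> blow_up k n d X" using Mc by (simp add: blow_up_def)
next
  fix M assume "M \<in> blow_up k n d X"
  then have M: "M \<in> carrier_mat (k * d) (n * d)" and sl: "\<And>a b. a < d \<Longrightarrow> b < d \<Longrightarrow> slice k n d a b M \<in> X"
    by (auto simp: blow_up_def)
  define Z where "Z e = slice k n d (e div d) (e mod d) M" for e
  define T where "T e = mat d d (\<lambda>(a, b). if e = a * d + b then 1 else (0::'a))" for e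
  have T: "T e \<in> carrier_mat d d" for e by (simp add: T_def)
  have Zc: "Z e \<in> carrier_mat k n" for e by (simp add: Z_def)
  have Z: "Z e \<in> X" if "e < d * d" for e
    unfolding Z_def using that by (intro sl div_less_block mod_less_block)
  have kc: "kronecker (Z e) (T e) \<in> carrier_mat (k * d) (n * d)" for e
    using Zc T by (rule kronecker_carrier)
  let ?S = "\<Oplus>\<^bsub>module_mat TYPE('a) (k * d) (n * d)\<^esub> e \<in> {..<d * d}. kronecker (Z e) (T e)"
  have S: "?S \<in> carrier_mat (k * d) (n * d)"
    "\<And>p q. p < k * d \<Longrightarrow> q < n * d \<Longrightarrow> ?S $$ (p, q) = (\<Sum>e<d * d. kronecker (Z e) (T e) $$ (p, q))"
    using finsum_module_mat_index[of "d * d" "\<lambda>e. kronecker (Z e) (T e)", OF kc] by auto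
  have "M = ?S"
  proof (rule eq_matI)
    fix p q assume "p < dim_row ?S" "q < dim_col ?S"
    then have p: "p < k * d" and q: "q < n * d" using S(1) by auto
    define e0 where "e0 = p mod d * d + q mod d"
    have pm: "p mod d < d" "q mod d < d" using mod_less_block p q by auto
    have e0: "e0 < d * d" unfolding e0_def using pm by (rule block_index_less)
    have e0': "e0 div d = p mod d" "e0 mod d = q mod d" using pm by (auto simp: e0_def)
    have "kronecker (Z e) (T e) $$ (p, q) = (if e = e0 then M $$ (p, q) else 0)" for e
      using p q pm e0' div_less_block[OF p] div_less_block[OF q] Zc[of e] T[of e]
      by (auto simp: kronecker_def e0_def[symmetric] T_def Z_def slice_def)
    then show "M $$ (p, q) = ?S $$ (p, q)"
      using S(2)[OF p q] e0 by simp
  qed (use M S in auto)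
  then show "M \<in> tensor_blow_up k n d X"
    unfolding tensor_blow_up_def using Z T by blast
qed

lemma matrix_space_image:
  assumes X: "matrix_space k n X" and G: "G \<in> carrier_mat k' k" and H: "H \<in> carrier_mat n n'"
  shows "matrix_space k' n' ((\<lambda>Z. G * Z * H) ` X)"
proof -
  note [simp] = carrier_matD[OF G] carrier_matD[OF H]
  have Xd: "dim_row Z = k" "dim_col Z = n" if "Z \<in> X" for Z
    using X that by (auto simp: matrix_space_def)
  have "G * A * H + G * B * H = G * (A + B) * H" if "A \<in> X" "B \<in> X" for A B
    using that by (simp add: mat_dim_simps Xd)
  moreover have "c \<cdot>\<^sub>m (G * A * H) = G * (c \<cdot>\<^sub>m A) * H" if "A \<in> X" for A c
    using that by (simp add: mult_smult_mat_dim smult_mult_mat_dim Xd)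
  moreover have "0\<^sub>m k' n' \<in> (\<lambda>Z. G * Z * H) ` X"
    using X by (intro image_eqI[of _ _ "0\<^sub>m k n"]) (auto simp: matrix_space_def)
  moreover have "G * A * H \<in> carrier_mat k' n'" if "A \<in> X" for A
    by (rule carrier_matI) simp_all
  ultimately show ?thesis
    using X unfolding matrix_space_def by (auto intro!: imageI)
qed

lemma sum_residue_class:
  fixes h :: "nat \<Rightarrow> 'b::comm_monoid_add"
  assumes "a < d"
  shows "(\<Sum>p = 0..<k * d. if p mod d = a then h p else 0) = (\<Sum>l = 0..<k. h (l * d + a))"
proof -
  have "{p \<in> {0..<k * d}. p mod d = a} = (\<lambda>l. l * d + a) ` {0..<k}"
  proof (intro equalityI subsetI)
    fix p assume "p \<in> {p \<in> {0..<k * d}. p mod d = a}"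
    then have "p = p div d * d + a" "p div d \<in> {0..<k}"
      using div_less_block[of p k d] by auto
    then show "p \<in> (\<lambda>l. l * d + a) ` {0..<k}" by blast
  qed (use assms block_index_less in auto)
  moreover have "inj_on (\<lambda>l. l * d + a) {0..<k}" using assms by (intro inj_onI) auto
  ultimately show ?thesis
    by (simp add: sum.inter_filter[symmetric] sum.reindex)
qed

lemma slice_kronecker_mult:
  fixes A :: "'a::field mat"
  assumes A: "A \<in> carrier_mat m k" and M: "M \<in> carrier_mat (k * d) (n * d)" and ab: "a < d" "b < d"
  shows "slice m n d a b (kronecker A (1\<^sub>m d) * M) = A * slice k n d a b M"
proof (rule eq_matI)
  fix i j assume "i < dim_row (A * slice k n d a b M)" "j < dim_col (A * slice k n d a b M)"
  then have ij: "i < m" "j < n" using A by (auto simp: slice_def)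
  have "slice m n d a b (kronecker A (1\<^sub>m d) * M) $$ (i, j)
      = (\<Sum>p = 0..<k * d. kronecker A (1\<^sub>m d) $$ (i * d + a, p) * M $$ (p, j * d + b))"
    using ij ab A M block_index_less by (simp add: slice_def scalar_prod_def kronecker_def)
  also have "\<dots> = (\<Sum>p = 0..<k * d. if p mod d = a then A $$ (i, p div d) * M $$ (p, j * d + b) else 0)"
    using ij ab A block_index_less[OF ij(1) ab(1)] mod_less_block
    by (intro sum.cong refl) (auto simp: kronecker_def)
  also have "\<dots> = (\<Sum>l = 0..<k. A $$ (i, l) * M $$ (l * d + a, j * d + b))"
    using ab by (subst sum_residue_class) auto
  also have "\<dots> = (A * slice k n d a b M) $$ (i, j)"
    using ij A by (simp add: slice_def scalar_prod_def)
  finally show "slice m n d a b (kronecker A (1\<^sub>m d) * M) $$ (i, j) = (A * slice k n d a b M) $$ (i, j)" .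
qed (use A in \<open>auto simp: slice_def\<close>)

lemma slice_mult_kronecker:
  fixes A :: "'a::field mat"
  assumes A: "A \<in> carrier_mat n m" and M: "M \<in> carrier_mat (k * d) (n * d)" and ab: "a < d" "b < d"
  shows "slice k m d a b (M * kronecker A (1\<^sub>m d)) = slice k n d a b M * A"
proof (rule eq_matI)
  fix i j assume "i < dim_row (slice k n d a b M * A)" "j < dim_col (slice k n d a b M * A)"
  then have ij: "i < k" "j < m" using A by (auto simp: slice_def)
  have "slice k m d a b (M * kronecker A (1\<^sub>m d)) $$ (i, j)
      = (\<Sum>p = 0..<n * d. M $$ (i * d + a, p) * kronecker A (1\<^sub>m d) $$ (p, j * d + b))"
    using ij ab A M block_index_less by (simp add: slice_def scalar_prod_def kronecker_def)
  also have "\<dots> = (\<Sum>p = 0..<n * d. if p mod d = b then M $$ (i * d + a, p) * A $$ (p div d, j) else 0)"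
    using ij ab A block_index_less[OF ij(2) ab(2)] mod_less_block
    by (intro sum.cong refl) (auto simp: kronecker_def)
  also have "\<dots> = (\<Sum>l = 0..<n. M $$ (i * d + a, l * d + b) * A $$ (l, j))"
    using ab by (subst sum_residue_class) auto
  also have "\<dots> = (slice k n d a b M * A) $$ (i, j)"
    using ij A by (simp add: slice_def scalar_prod_def)
  finally show "slice k m d a b (M * kronecker A (1\<^sub>m d)) $$ (i, j) = (slice k n d a b M * A) $$ (i, j)" .
qed (use A in \<open>auto simp: slice_def\<close>)

lemma blow_up_image:
  fixes X :: "'a::field mat set"
  assumes M: "M \<in> blow_up k n d X" and G: "G \<in> carrier_mat k' k" and H: "H \<in> carrier_mat n n'"
  shows "kronecker G (1\<^sub>m d) * M * kronecker H (1\<^sub>m d) \<in> blow_up k' n' d ((\<lambda>Z. G * Z * H) ` X)"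
    and "\<And>a b. a < d \<Longrightarrow> b < d \<Longrightarrow>
      slice k' n' d a b (kronecker G (1\<^sub>m d) * M * kronecker H (1\<^sub>m d)) = G * slice k n d a b M * H"
proof -
  have Mc: "M \<in> carrier_mat (k * d) (n * d)" using M by (simp add: blow_up_def)
  have Gc: "kronecker G (1\<^sub>m d) \<in> carrier_mat (k' * d) (k * d)"
    and Hc: "kronecker H (1\<^sub>m d) \<in> carrier_mat (n * d) (n' * d)"
    using G H by (auto intro!: kronecker_carrier)
  have GMc: "kronecker G (1\<^sub>m d) * M \<in> carrier_mat (k' * d) (n * d)" using Gc Mc by auto
  show sl: "slice k' n' d a b (kronecker G (1\<^sub>m d) * M * kronecker H (1\<^sub>m d)) = G * slice k n d a b M * H"
    if "a < d" "b < d" for a b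
    using that by (simp add: slice_mult_kronecker[OF H GMc] slice_kronecker_mult[OF G Mc])
  show "kronecker G (1\<^sub>m d) * M * kronecker H (1\<^sub>m d) \<in> blow_up k' n' d ((\<lambda>Z. G * Z * H) ` X)"
    using M GMc Hc sl unfolding blow_up_def by auto
qed

section \<open>The rank of a blow-up is divisible by its size\<close>

lemma det_scale_cols:
  fixes a :: "nat \<Rightarrow> nat \<Rightarrow> 'r::comm_ring_1"
  shows "det (mat c c (\<lambda>(x, y). a x y * v y)) = det (mat c c (\<lambda>(x, y). a x y)) * (\<Prod>y = 0..<c. v y)"
proof -
  have "(\<Prod>i = 0..<c. v (p i)) = (\<Prod>i = 0..<c. v i)" if "p permutes {0..<c}" for p
    using prod.permute[OF that, of v] by (simp add: comp_def)
  moreover have "p i < c" if "p permutes {0..<c}" "i < c" for p i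
    using permutes_in_image[OF that(1), of i] that(2) by simp
  ultimately show ?thesis
    by (auto simp: det_def'[of _ c] prod.distrib sum_distrib_right mult.assoc intro!: sum.cong)
qed

lemma det_scale_rows:
  fixes a :: "nat \<Rightarrow> nat \<Rightarrow> 'r::comm_ring_1"
  shows "det (mat c c (\<lambda>(x, y). a x y * u x)) = det (mat c c (\<lambda>(x, y). a x y)) * (\<Prod>x = 0..<c. u x)"
proof -
  have "p i < c" if "p permutes {0..<c}" "i < c" for p i
    using permutes_in_image[OF that(1), of i] that(2) by simp
  then show ?thesis
    by (auto simp: det_def'[of _ c] prod.distrib sum_distrib_right mult.assoc intro!: sum.cong)
qed

text \<open>The cyclic permutation of the \<open>d\<close> coordinates within each block.\<close>

definition cyc :: "nat \<Rightarrow> nat \<Rightarrow> nat" where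
  "cyc d p = p div d * d + (p mod d + 1) mod d"

lemma cyc_div_mod:
  assumes "0 < d"
  shows "cyc d p div d = p div d" "cyc d p mod d = (p mod d + 1) mod d"
  using assms by (auto simp: cyc_def)

lemma cyc_less: "p < k * d \<Longrightarrow> cyc d p < k * d"
  unfolding cyc_def using mod_less_block[of p k d] by (intro block_index_less div_less_block) auto

lemma cyc_funpow:
  assumes "0 < d"
  shows "(cyc d ^^ t) p = p div d * d + (p mod d + t) mod d"
proof (induction t)
  case (Suc t)
  have "(cyc d ^^ Suc t) p = cyc d (p div d * d + (p mod d + t) mod d)" using Suc by simp
  also have "\<dots> = p div d * d + ((p mod d + t) mod d + 1) mod d"
    using assms by (simp add: cyc_def)
  finally show ?case by (simp add: mod_Suc_eq)
qed (use assms in simp)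

lemma cyc_funpow_less: "p < k * d \<Longrightarrow> (cyc d ^^ t) p < k * d"
  by (induction t) (auto intro: cyc_less)

text \<open>Permuting the coordinates within the blocks permutes the slices.\<close>

lemma permute_blow_up:
  assumes M: "M \<in> blow_up k n d X" and s: "\<And>a. a < d \<Longrightarrow> s a < d"
  shows "mat (k * d) (n * d) (\<lambda>(p, q). M $$ (p div d * d + s (p mod d), q div d * d + s (q mod d))) \<in> blow_up k n d X"
    (is "?M \<in> _")
proof -
  have "slice k n d a b ?M = slice k n d (s a) (s b) M" if "a < d" "b < d" for a b
    using that s by (intro eq_matI) (auto simp: slice_def block_index_less)
  then show ?thesis using M s by (auto simp: blow_up_def)
qed

lemma ex_cyc_shifted:
  assumes M: "M \<in> blow_up k n d X" and d: "0 < d"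
  obtains M' where "M' \<in> blow_up k n d X"
    "\<And>p q. p < k * d \<Longrightarrow> q < n * d \<Longrightarrow> M' $$ (cyc d p, cyc d q) = M $$ (p, q)"
proof -
  define s where "s a = (a + (d - 1)) mod d" for a
  let ?M = "mat (k * d) (n * d) (\<lambda>(p, q). M $$ (p div d * d + s (p mod d), q div d * d + s (q mod d)))"
  have s: "s ((a + 1) mod d) = a" if "a < d" for a
    using that by (cases "Suc a = d") (auto simp: s_def mod_if)
  show thesis
  proof (rule that[of ?M])
    show "?M \<in> blow_up k n d X" using M d by (intro permute_blow_up) (auto simp: s_def)
    fix p q assume "p < k * d" "q < n * d"
    then show "?M $$ (cyc d p, cyc d q) = M $$ (p, q)"
      using d by (simp add: cyc_less cyc_div_mod s[unfolded Suc_eq_plus1[symmetric]])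
  qed
qed

lemma ex_cyc_unshifted:
  assumes M: "M' \<in> blow_up k n d X" and d: "0 < d"
  obtains M where "M \<in> blow_up k n d X"
    "\<And>p q. p < k * d \<Longrightarrow> q < n * d \<Longrightarrow> M' $$ (cyc d p, cyc d q) = M $$ (p, q)"
proof -
  let ?M = "mat (k * d) (n * d) (\<lambda>(p, q). M' $$ (p div d * d + (p mod d + 1) mod d, q div d * d + (q mod d + 1) mod d))"
  show thesis
    by (rule that[of ?M]) (use permute_blow_up[OF M, of "\<lambda>a. (a + 1) mod d"] d in \<open>auto simp: cyc_def\<close>)
qed

text \<open>The variable \<open>w = [:0, 1:]\<close> is put at the places below the diagonal of each \<open>d \<times> d\<close> block.\<close>

definition twisted_entry :: "nat \<Rightarrow> 'a::comm_ring_1 mat \<Rightarrow> nat \<Rightarrow> nat \<Rightarrow> 'a poly" where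
  "twisted_entry d M p q = [:M $$ (p, q):] * [:0, 1:] ^ (if q mod d < p mod d then 1 else 0)"

definition twisted_minor :: "nat \<Rightarrow> nat \<Rightarrow> 'a::comm_ring_1 mat \<Rightarrow> (nat \<Rightarrow> nat) \<Rightarrow> (nat \<Rightarrow> nat) \<Rightarrow> 'a poly" where
  "twisted_minor d c M f g = det (mat c c (\<lambda>(x, y). twisted_entry d M (f x) (g y)))"

text \<open>The number of selected indices that the next cyclic step sends back to the first coordinate.\<close>

definition wraps :: "nat \<Rightarrow> nat \<Rightarrow> (nat \<Rightarrow> nat) \<Rightarrow> nat" where
  "wraps d c f = (\<Sum>x = 0..<c. if f x mod d = d - 1 then 1 else 0)"

text \<open>A cyclic step preserves the relative position of two coordinates except when exactly one of them
  wraps around. The two powers of \<open>w\<close> compensate for this.\<close>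

lemma twisted_entry_cyc:
  assumes "0 < d" and "M' $$ (cyc d p, cyc d q) = M $$ (p, q)"
  shows "twisted_entry d M p q * [:0, 1:] ^ (if q mod d = d - 1 then 1 else 0)
    = twisted_entry d M' (cyc d p) (cyc d q) * [:0, 1:] ^ (if p mod d = d - 1 then 1 else 0)"
proof -
  define a b where "a = p mod d" and "b = q mod d"
  have ab: "a < d" "b < d" using \<open>0 < d\<close> by (auto simp: a_def b_def)
  have wrap: "(x + 1) mod d = (if x = d - 1 then 0 else x + 1)" if "x < d" for x
    using that by (auto simp: mod_Suc)
  have "(if b < a then 1 else 0) + (if b = d - 1 then 1 else 0)
      = (if (b + 1) mod d < (a + 1) mod d then 1 else 0) + (if a = d - 1 then 1 else (0::nat))"
    using ab unfolding wrap[OF ab(1)] wrap[OF ab(2)] by auto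
  then show ?thesis
    using assms unfolding twisted_entry_def cyc_div_mod[OF \<open>0 < d\<close>] mult.assoc power_add[symmetric]
    by (simp add: a_def b_def del: One_nat_def)
qed

lemma twisted_minor_cyc:
  fixes M :: "'a::comm_ring_1 mat"
  assumes "0 < d" and "\<And>p q. p < k * d \<Longrightarrow> q < n * d \<Longrightarrow> M' $$ (cyc d p, cyc d q) = M $$ (p, q)"
    and f: "\<And>x. x < c \<Longrightarrow> f x < k * d" and g: "\<And>x. x < c \<Longrightarrow> g x < n * d"
  shows "twisted_minor d c M f g * [:0, 1:] ^ wraps d c g
    = twisted_minor d c M' (cyc d \<circ> f) (cyc d \<circ> g) * [:0, 1:] ^ wraps d c f"
proof -
  let ?e = "\<lambda>p. [:0, 1:] ^ (if p mod d = d - 1 then 1 else 0) :: 'a poly"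
  have "det (mat c c (\<lambda>(x, y). twisted_entry d M (f x) (g y) * ?e (g y)))
      = det (mat c c (\<lambda>(x, y). twisted_entry d M' (cyc d (f x)) (cyc d (g y)) * ?e (f x)))"
  proof (intro arg_cong[of _ _ det] cong_mat refl)
    fix x y assume "x < c" "y < c"
    then show "(case (x, y) of (x, y) \<Rightarrow> twisted_entry d M (f x) (g y) * ?e (g y))
        = (case (x, y) of (x, y) \<Rightarrow> twisted_entry d M' (cyc d (f x)) (cyc d (g y)) * ?e (f x))"
      unfolding prod.case using assms by (intro twisted_entry_cyc) auto
  qed
  then show ?thesis
    unfolding det_scale_cols[of c "\<lambda>x y. twisted_entry d M (f x) (g y)" "\<lambda>y. ?e (g y)"]
      det_scale_rows[of c "\<lambda>x y. twisted_entry d M' (cyc d (f x)) (cyc d (g y))" "\<lambda>x. ?e (f x)"]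
    by (simp add: twisted_minor_def wraps_def power_sum)
qed

text \<open>In \<open>d\<close> cyclic steps, every index wraps around exactly once.\<close>

lemma sum_wraps_orbit:
  assumes "0 < d"
  shows "(\<Sum>t<d. wraps d c ((cyc d ^^ t) \<circ> f)) = c"
proof -
  have one: "(\<Sum>t<d. if (a + t) mod d = d - 1 then 1 else 0 :: nat) = 1" if "a < d" for a
  proof -
    have "(a + t) mod d = d - 1 \<longleftrightarrow> t = d - 1 - a" if "t < d" for t
    proof (cases "a + t < d")
      case True
      then show ?thesis by auto
    next
      case False
      then have "(a + t) mod d = a + t - d" using \<open>a < d\<close> \<open>t < d\<close> by (simp add: mod_if)
      then show ?thesis using False \<open>a < d\<close> \<open>t < d\<close> by auto
    qed
    then have "(\<Sum>t<d. if (a + t) mod d = d - 1 then 1 else 0 :: nat) = (\<Sum>t<d. if t = d - 1 - a then 1 else 0)"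
      by (intro sum.cong) auto
    also have "\<dots> = 1" using \<open>a < d\<close> by simp
    finally show ?thesis .
  qed
  have "(\<Sum>t<d. wraps d c ((cyc d ^^ t) \<circ> f))
      = (\<Sum>x = 0..<c. \<Sum>t<d. if (f x mod d + t) mod d = d - 1 then 1 else 0)"
    unfolding wraps_def using assms by (subst sum.swap) (simp add: cyc_funpow)
  also have "\<dots> = (\<Sum>x = 0..<c. 1)"
    by (intro sum.cong refl one) (use assms in auto)
  finally show ?thesis by simp
qed

lemma poly_twisted_minor:
  fixes M :: "'a::comm_ring_1 mat"
  assumes f: "\<And>x. x < c \<Longrightarrow> f x < k * d" and g: "\<And>x. x < c \<Longrightarrow> g x < n * d"
  shows "poly (twisted_minor d c M f g) w = det (mat c c (\<lambda>(x, y).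
    mat (k * d) (n * d) (\<lambda>(p, q). M $$ (p, q) * w ^ (if q mod d < p mod d then 1 else 0)) $$ (f x, g y)))"
proof -
  have "poly (signof p) w = signof p" for p :: "nat \<Rightarrow> nat" by (simp add: sign_def)
  moreover have "p i < c" if "p permutes {0..<c}" "i < c" for p i
    using permutes_in_image[OF that(1), of i] that(2) by simp
  ultimately show ?thesis
    using f g by (auto simp: twisted_minor_def twisted_entry_def det_def'[of _ c] poly_sum poly_prod
      intro!: sum.cong prod.cong arg_cong2[where f = "(*)"])
qed

text \<open>Specializing \<open>w\<close> to a scalar rescales the slices, so it stays in the blow-up. Hence a rank bound on
  the blow-up also bounds the rank of the matrices with \<open>w\<close>.\<close>

lemma twisted_blow_up:
  fixes M :: "'a::field mat"
  assumes "M \<in> blow_up k n d X" and X: "matrix_space k n X"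
  shows "mat (k * d) (n * d) (\<lambda>(p, q). M $$ (p, q) * w ^ (if q mod d < p mod d then 1 else 0)) \<in> blow_up k n d X"
    (is "?M \<in> _")
proof -
  have "slice k n d a b ?M = w ^ (if b < a then 1 else 0) \<cdot>\<^sub>m slice k n d a b M" if "a < d" "b < d" for a b
    using that by (intro eq_matI) (auto simp: slice_def block_index_less)
  then show ?thesis using assms by (auto simp: blow_up_def matrix_space_def)
qed

lemma degree_twisted_minor: "degree (twisted_minor d c M f g) \<le> c"
proof -
  have "degree (twisted_entry d M p q) \<le> 1" for p q by (simp add: twisted_entry_def)
  then have "degree (\<Prod>i = 0..<c. mat c c (\<lambda>(x, y). twisted_entry d M (f x) (g y)) $$ (i, p i)) \<le> c"
    if "p permutes {0..<c}" for p
  proof -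
    have "p i < c" if "i < c" for i
      using permutes_in_image[OF \<open>p permutes _\<close>, of i] that by simp
    then have "(\<Sum>i = 0..<c. degree (mat c c (\<lambda>(x, y). twisted_entry d M (f x) (g y)) $$ (i, p i))) \<le> (\<Sum>i = 0..<c. 1)"
      using \<open>\<And>p q. degree (twisted_entry d M p q) \<le> 1\<close> by (intro sum_mono) auto
    then show ?thesis
      using degree_prod_sum_le[of "{0..<c}" "\<lambda>i. mat c c (\<lambda>(x, y). twisted_entry d M (f x) (g y)) $$ (i, p i)"]
      by (simp add: comp_def)
  qed
  then have "degree (signof p * (\<Prod>i = 0..<c. mat c c (\<lambda>(x, y). twisted_entry d M (f x) (g y)) $$ (i, p i))) \<le> c"
    if "p permutes {0..<c}" for p
    using that by (auto simp: sign_def)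
  then show ?thesis
    unfolding twisted_minor_def det_def'[OF mat_carrier]
    by (intro degree_sum_le) (auto simp: finite_permutations)
qed

lemma poly_fun_coeff_twisted_minor:
  fixes M :: "'a::comm_ring_1 mat"
  assumes M: "M \<in> carrier_mat (k * d) (n * d)" and N: "N \<in> carrier_mat (k * d) (n * d)"
    and f: "\<And>x. x < c \<Longrightarrow> f x < k * d" and g: "\<And>x. x < c \<Longrightarrow> g x < n * d"
  shows "poly_fun (\<lambda>t. coeff (twisted_minor d c (mat_line M N t) f g) h)"
proof -
  define P where "P F \<longleftrightarrow> (\<forall>h. poly_fun (\<lambda>t. coeff (F t) h))" for F :: "'a \<Rightarrow> 'a poly"
  have const: "P (\<lambda>_. q)" for q by (simp add: P_def poly_fun_const)
  have add: "P (\<lambda>t. F t + G t)" if "P F" "P G" for F G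
    using that by (simp add: P_def poly_fun_add)
  have mult: "P (\<lambda>t. F t * G t)" if "P F" "P G" for F G
    using that unfolding P_def coeff_mult
    by (intro allI sum_closed[where P = poly_fun] poly_fun_const poly_fun_add poly_fun_mult) auto
  have line: "poly_fun (\<lambda>t. mat_line M N t $$ (p, q))" if "p < k * d" "q < n * d" for p q
    using poly_mat_line[OF M N] that unfolding poly_mat_def by blast
  have "P (\<lambda>t. [:mat_line M N t $$ (p, q):])" if "p < k * d" "q < n * d" for p q
    unfolding P_def
  proof
    fix h show "poly_fun (\<lambda>t. coeff [:mat_line M N t $$ (p, q):] h)"
      using line[OF that] by (cases h) (auto simp: poly_fun_const)
  qed
  then have "P (\<lambda>t. twisted_entry d (mat_line M N t) p q)" if "p < k * d" "q < n * d" for p q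
    unfolding twisted_entry_def using that by (intro mult const)
  then have "P (\<lambda>t. twisted_minor d c (mat_line M N t) f g)"
    unfolding twisted_minor_def by (intro det_closed[where P = P and n = c] const add mult) (auto simp: f g)
  then show ?thesis by (simp add: P_def)
qed

locale maximal_blow_up_rank =
  fixes k n d c :: nat and X :: "'a::field mat set"
  assumes inf: "infinite (UNIV :: 'a set)"
    and space: "matrix_space k n X"
    and d: "0 < d"
    and attained: "\<exists>M \<in> blow_up k n d X. rank_at_least c M"
    and maximal: "\<And>M r. M \<in> blow_up k n d X \<Longrightarrow> rank_at_least r M \<Longrightarrow> r \<le> c"
begin

definition row_sel :: "(nat \<Rightarrow> nat) \<Rightarrow> bool" where "row_sel f \<longleftrightarrow> (\<forall>x<c. f x < k * d)"
definition col_sel :: "(nat \<Rightarrow> nat) \<Rightarrow> bool" where "col_sel g \<longleftrightarrow> (\<forall>x<c. g x < n * d)"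

abbreviation "Y \<equiv> blow_up k n d X"
abbreviation "\<mu> \<equiv> twisted_minor d c"

lemma Y_carrier: "M \<in> Y \<Longrightarrow> M \<in> carrier_mat (k * d) (n * d)"
  by (simp add: blow_up_def)

text \<open>For each value of \<open>w\<close> the specialized matrix lies in the blow-up and so has rank at most \<open>c\<close>. The
  field is infinite, so the identity between minors lifts to polynomials.\<close>

lemma twisted_minors_rank_one:
  assumes "M \<in> Y" "row_sel f" "row_sel f'" "col_sel g" "col_sel g'"
  shows "\<mu> M f g * \<mu> M f' g' = \<mu> M f g' * \<mu> M f' g"
proof -
  have "poly (\<mu> M f g * \<mu> M f' g' - \<mu> M f g' * \<mu> M f' g) w = 0" for w
  proof -
    define N where "N = mat (k * d) (n * d) (\<lambda>(p, q). M $$ (p, q) * w ^ (if q mod d < p mod d then 1 else 0))"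
    have N: "N \<in> Y" unfolding N_def by (rule twisted_blow_up[OF \<open>M \<in> Y\<close> space])
    note dims = carrier_matD[OF Y_carrier[OF N]]
    obtain r F E where F: "F \<in> carrier_mat r (k * d)" and E: "E \<in> carrier_mat (n * d) r"
      and FNE: "F * N * E = 1\<^sub>m r" "N * E * F * N = N"
      by (rule generalized_inverse_exists[OF Y_carrier[OF N]])
    have "rank_at_least r N"
      unfolding rank_at_least_def dims using F E FNE(1) by blast
    then have "r \<le> c" by (rule maximal[OF N])
    have fact: "N = (N * E) * (F * N)"
      using FNE(2) F E dims by (simp add: assoc_mult_mat_dim)
    have "\<And>f g. row_sel f \<Longrightarrow> col_sel g \<Longrightarrow> poly (\<mu> M f g) w = det (mat c c (\<lambda>(x, y). N $$ (f x, g y)))"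
      unfolding N_def by (rule poly_twisted_minor) (auto simp: row_sel_def col_sel_def)
    moreover have "N * E \<in> carrier_mat (k * d) r" "F * N \<in> carrier_mat r (n * d)"
      using F E dims by (auto intro!: carrier_matI)
    note minors_rank_one[OF this \<open>r \<le> c\<close>, folded fact, of f f' g g']
    ultimately show ?thesis using assms by (simp add: row_sel_def col_sel_def)
  qed
  then have "\<mu> M f g * \<mu> M f' g' - \<mu> M f g' * \<mu> M f' g = 0"
    using poly_roots_finite[of "\<mu> M f g * \<mu> M f' g' - \<mu> M f g' * \<mu> M f' g"] inf by auto
  then show ?thesis by simp
qed

definition gen_nonzero :: "(nat \<Rightarrow> nat) \<Rightarrow> (nat \<Rightarrow> nat) \<Rightarrow> bool" where
  "gen_nonzero f g \<longleftrightarrow> (\<exists>M\<in>Y. \<mu> M f g \<noteq> 0)"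

text \<open>The degree in \<open>w\<close> of the minor of a generic member of the blow-up. As the maximum runs over all members
  and cyclic steps permute them, a step applied to the matrix can be ignored.\<close>

definition generic_degree :: "(nat \<Rightarrow> nat) \<Rightarrow> (nat \<Rightarrow> nat) \<Rightarrow> nat" where
  "generic_degree f g = Max {degree (\<mu> M f g) | M. M \<in> Y \<and> \<mu> M f g \<noteq> 0}"

lemma finite_degrees: "finite {degree (\<mu> M f g) | M. M \<in> Y \<and> \<mu> M f g \<noteq> 0}"
  by (rule finite_subset[of _ "{..c}"]) (auto intro: degree_twisted_minor)

lemma degree_le_generic_degree: "M \<in> Y \<Longrightarrow> \<mu> M f g \<noteq> 0 \<Longrightarrow> degree (\<mu> M f g) \<le> generic_degree f g"
  unfolding generic_degree_def by (rule Max_ge[OF finite_degrees]) auto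

lemma generic_degree_attained:
  assumes "gen_nonzero f g"
  obtains M where "M \<in> Y" "\<mu> M f g \<noteq> 0" "degree (\<mu> M f g) = generic_degree f g"
proof -
  have "generic_degree f g \<in> {degree (\<mu> M f g) | M. M \<in> Y \<and> \<mu> M f g \<noteq> 0}"
    unfolding generic_degree_def using assms by (intro Max_in finite_degrees) (auto simp: gen_nonzero_def)
  then show thesis using that by auto
qed

lemma generic_degrees:
  assumes "finite I" and I: "\<And>f g. (f, g) \<in> I \<Longrightarrow> row_sel f \<and> col_sel g \<and> gen_nonzero f g"
  obtains M where "M \<in> Y" "\<And>f g. (f, g) \<in> I \<Longrightarrow> \<mu> M f g \<noteq> 0 \<and> degree (\<mu> M f g) = generic_degree f g"
proof -
  let ?\<phi> = "\<lambda>i M. coeff (\<mu> M (fst i) (snd i)) (generic_degree (fst i) (snd i))"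
  have Y: "matrix_space (k * d) (n * d) Y" by (rule matrix_space_blow_up[OF space])
  have "\<exists>M\<in>Y. \<forall>i\<in>I. ?\<phi> i M \<noteq> 0"
  proof (rule generic_point[OF inf _ _ _ \<open>finite I\<close>])
    show "Y \<subseteq> carrier_mat (k * d) (n * d)" "Y \<noteq> {}" using Y by (auto simp: matrix_space_def)
    show "mat_line M N t \<in> Y" if "M \<in> Y" "N \<in> Y" for M N t
      using that Y by (simp add: matrix_space_def mat_line_def)
    show "poly_fun (\<lambda>t. ?\<phi> i (mat_line M N t))" if "i \<in> I" "M \<in> Y" "N \<in> Y" for i M N
      using that I[of "fst i" "snd i"]
      by (intro poly_fun_coeff_twisted_minor[OF Y_carrier Y_carrier]) (auto simp: row_sel_def col_sel_def)
    show "\<exists>M\<in>Y. ?\<phi> i M \<noteq> 0" if "i \<in> I" for i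
    proof -
      obtain M where "M \<in> Y" "\<mu> M (fst i) (snd i) \<noteq> 0"
        "degree (\<mu> M (fst i) (snd i)) = generic_degree (fst i) (snd i)"
        using generic_degree_attained I[of "fst i" "snd i"] \<open>i \<in> I\<close> by auto
      then show ?thesis by (metis leading_coeff_0_iff)
    qed
  qed
  then obtain M where M: "M \<in> Y" "\<forall>i\<in>I. ?\<phi> i M \<noteq> 0" by blast
  show thesis
  proof (rule that[OF M(1)])
    fix f g assume "(f, g) \<in> I"
    then have c: "coeff (\<mu> M f g) (generic_degree f g) \<noteq> 0" using M(2) by auto
    then have "\<mu> M f g \<noteq> 0" by auto
    moreover from this have "degree (\<mu> M f g) \<le> generic_degree f g" by (rule degree_le_generic_degree[OF M(1)])
    ultimately show "\<mu> M f g \<noteq> 0 \<and> degree (\<mu> M f g) = generic_degree f g"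
      using le_degree[OF c] by simp
  qed
qed

lemma degree_cyc:
  assumes "M' \<in> Y" and "\<And>p q. p < k * d \<Longrightarrow> q < n * d \<Longrightarrow> M' $$ (cyc d p, cyc d q) = M $$ (p, q)"
    and "row_sel f" "col_sel g"
  shows "\<mu> M f g \<noteq> 0 \<longleftrightarrow> \<mu> M' (cyc d \<circ> f) (cyc d \<circ> g) \<noteq> 0"
    and "\<mu> M f g \<noteq> 0 \<Longrightarrow> degree (\<mu> M f g) + wraps d c g = degree (\<mu> M' (cyc d \<circ> f) (cyc d \<circ> g)) + wraps d c f"
proof -
  have eq: "\<mu> M f g * [:0, 1:] ^ wraps d c g = \<mu> M' (cyc d \<circ> f) (cyc d \<circ> g) * [:0, 1:] ^ wraps d c f"
    by (rule twisted_minor_cyc[OF d assms(2)]) (use assms in \<open>auto simp: row_sel_def col_sel_def\<close>)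
  have nz: "[:0, 1:] ^ l \<noteq> (0 :: 'a poly)" for l by simp
  show iff: "\<mu> M f g \<noteq> 0 \<longleftrightarrow> \<mu> M' (cyc d \<circ> f) (cyc d \<circ> g) \<noteq> 0"
    using eq nz by (metis mult_eq_0_iff)
  have deg: "degree (p * [:0, 1:] ^ l) = degree p + l" if "p \<noteq> 0" for p :: "'a poly" and l
    using that nz by (simp add: degree_mult_eq degree_power_eq)
  show "degree (\<mu> M f g) + wraps d c g = degree (\<mu> M' (cyc d \<circ> f) (cyc d \<circ> g)) + wraps d c f" if "\<mu> M f g \<noteq> 0"
    using arg_cong[OF eq, of degree] that iff by (simp add: deg)
qed

lemma gen_nonzero_cyc:
  assumes "row_sel f" "col_sel g" "gen_nonzero f g"
  shows "gen_nonzero (cyc d \<circ> f) (cyc d \<circ> g)"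
proof -
  obtain M where M: "M \<in> Y" "\<mu> M f g \<noteq> 0" using assms by (auto simp: gen_nonzero_def)
  obtain M' where "M' \<in> Y" "\<And>p q. p < k * d \<Longrightarrow> q < n * d \<Longrightarrow> M' $$ (cyc d p, cyc d q) = M $$ (p, q)"
    using ex_cyc_shifted[OF M(1) d] by blast
  from degree_cyc(1)[OF this assms(1,2)] M \<open>M' \<in> Y\<close> show ?thesis by (auto simp: gen_nonzero_def)
qed

lemma generic_degree_cyc:
  assumes "row_sel f" "col_sel g" "gen_nonzero f g"
  shows "generic_degree f g + wraps d c g = generic_degree (cyc d \<circ> f) (cyc d \<circ> g) + wraps d c f"
proof (rule antisym)
  obtain M where M: "M \<in> Y" "\<mu> M f g \<noteq> 0" "degree (\<mu> M f g) = generic_degree f g"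
    using generic_degree_attained[OF assms(3)] by blast
  obtain M' where M': "M' \<in> Y" "\<And>p q. p < k * d \<Longrightarrow> q < n * d \<Longrightarrow> M' $$ (cyc d p, cyc d q) = M $$ (p, q)"
    using ex_cyc_shifted[OF M(1) d] by blast
  show "generic_degree f g + wraps d c g \<le> generic_degree (cyc d \<circ> f) (cyc d \<circ> g) + wraps d c f"
    using degree_cyc[OF M' assms(1,2)] M degree_le_generic_degree[OF M'(1), of "cyc d \<circ> f" "cyc d \<circ> g"] by simp
next
  obtain M' where M': "M' \<in> Y" "\<mu> M' (cyc d \<circ> f) (cyc d \<circ> g) \<noteq> 0"
    "degree (\<mu> M' (cyc d \<circ> f) (cyc d \<circ> g)) = generic_degree (cyc d \<circ> f) (cyc d \<circ> g)"
    using generic_degree_attained[OF gen_nonzero_cyc[OF assms]] by blast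
  obtain M where M: "M \<in> Y" "\<And>p q. p < k * d \<Longrightarrow> q < n * d \<Longrightarrow> M' $$ (cyc d p, cyc d q) = M $$ (p, q)"
    using ex_cyc_unshifted[OF M'(1) d] by blast
  show "generic_degree (cyc d \<circ> f) (cyc d \<circ> g) + wraps d c f \<le> generic_degree f g + wraps d c g"
    using degree_cyc[OF M'(1) M(2) assms(1,2)] M' degree_le_generic_degree[OF M(1), of f g] by simp
qed

text \<open>At a generic matrix both minors are nonzero, and their product is the product of the two minors with
  the column selections exchanged.\<close>

lemma gen_nonzero_exchange:
  assumes "gen_nonzero f g" "gen_nonzero f' g'" "row_sel f" "row_sel f'" "col_sel g" "col_sel g'"
  shows "gen_nonzero f g'"
proof -
  obtain M where "M \<in> Y"
    and gen: "\<And>a b. (a, b) \<in> {(f, g), (f', g')} \<Longrightarrow> \<mu> M a b \<noteq> 0 \<and> degree (\<mu> M a b) = generic_degree a b"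
    by (rule generic_degrees[of "{(f, g), (f', g')}"]) (use assms in auto)
  then have "\<mu> M f g \<noteq> 0" "\<mu> M f' g' \<noteq> 0" by auto
  then have "\<mu> M f g * \<mu> M f' g' \<noteq> 0" by simp
  also have "\<mu> M f g * \<mu> M f' g' = \<mu> M f g' * \<mu> M f' g"
    using \<open>M \<in> Y\<close> assms by (intro twisted_minors_rank_one)
  finally show ?thesis using \<open>M \<in> Y\<close> by (auto simp: gen_nonzero_def)
qed

text \<open>Let \<open>f t\<close> and \<open>g t\<close> be the \<open>t\<close>-fold cyclic shifts of the row and column selection of a nonzero minor,
  \<open>a\<^sub>t\<close> the generic degree for \<open>f t\<close>, \<open>g 0\<close>, and \<open>b\<^sub>t\<close> that for \<open>f t\<close>, \<open>g 1\<close>. The cyclic step gives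
  \<open>a\<^sub>t + wraps (g 0) = b\<^sub>t\<^sub>+\<^sub>1 + wraps (f t)\<close>, and the rank one relation says that \<open>b\<^sub>t - a\<^sub>t\<close> does not depend
  on \<open>t\<close>. Summed over \<open>t < d\<close>, the terms \<open>wraps (f t)\<close> give \<open>c\<close>, the sums of \<open>a\<close> and \<open>b\<close> cancel, and what is
  left is a multiple of \<open>d\<close>.\<close>

lemma size_dvd_rank: "d dvd c"
proof -
  obtain M0 where M0: "M0 \<in> Y" "rank_at_least c M0" using attained by blast
  obtain f0 g0 where f0: "\<And>x. x < c \<Longrightarrow> f0 x < k * d" and g0: "\<And>x. x < c \<Longrightarrow> g0 x < n * d"
    and minor: "det (mat c c (\<lambda>(x, y). M0 $$ (f0 x, g0 y))) \<noteq> 0"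
    using rank_at_least_imp_minor[OF Y_carrier[OF M0(1)] M0(2)] by blast
  have "poly (\<mu> M0 f0 g0) 1 = det (mat c c (\<lambda>(x, y).
      mat (k * d) (n * d) (\<lambda>(p, q). M0 $$ (p, q) * 1 ^ (if q mod d < p mod d then 1 else 0)) $$ (f0 x, g0 y)))"
    by (rule poly_twisted_minor) (use f0 g0 in auto)
  also have "\<dots> = det (mat c c (\<lambda>(x, y). M0 $$ (f0 x, g0 y)))"
    using f0 g0 by (intro arg_cong[of _ _ det] cong_mat) auto
  finally have "poly (\<mu> M0 f0 g0) 1 = det (mat c c (\<lambda>(x, y). M0 $$ (f0 x, g0 y)))" .
  then have "\<mu> M0 f0 g0 \<noteq> 0" using minor by (metis poly_0)
  then have nz0: "gen_nonzero f0 g0" using M0(1) by (auto simp: gen_nonzero_def)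
  define f where "f t = (cyc d ^^ t) \<circ> f0" for t
  define g where "g t = (cyc d ^^ t) \<circ> g0" for t
  have step: "f (Suc t) = cyc d \<circ> f t" "g (Suc t) = cyc d \<circ> g t" for t
    by (simp_all add: f_def g_def comp_assoc)
  have rf: "row_sel (f t)" and cg: "col_sel (g t)" for t
    using f0 g0 by (auto simp: f_def g_def row_sel_def col_sel_def cyc_funpow_less)
  have diag: "gen_nonzero (f t) (g t)" for t
  proof (induction t)
    case 0
    then show ?case using nz0 by (simp add: f_def g_def)
  next
    case (Suc t)
    then show ?case unfolding step by (intro gen_nonzero_cyc rf cg)
  qed
  have nz: "gen_nonzero (f s) (g t)" for s t
    by (rule gen_nonzero_exchange[OF diag diag]) (intro rf cg)+
  obtain M where M: "M \<in> Y" and gen_all: "\<And>a b. (a, b) \<in> f ` {..d} \<times> g ` {..1} \<Longrightarrow>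
      \<mu> M a b \<noteq> 0 \<and> degree (\<mu> M a b) = generic_degree a b"
    by (rule generic_degrees[of "f ` {..d} \<times> g ` {..1}"]) (use rf cg nz in auto)
  have gen: "\<mu> M (f s) (g t) \<noteq> 0 \<and> degree (\<mu> M (f s) (g t)) = generic_degree (f s) (g t)" if "s \<le> d" "t \<le> 1" for s t
    using that by (intro gen_all) auto
  have ranks: "generic_degree (f t) (g 1) + generic_degree (f 0) (g 0) = generic_degree (f t) (g 0) + generic_degree (f 0) (g 1)" if "t \<le> d" for t
  proof -
    have "\<mu> M (f t) (g 1) * \<mu> M (f 0) (g 0) = \<mu> M (f t) (g 0) * \<mu> M (f 0) (g 1)"
      by (rule twisted_minors_rank_one[OF M rf rf cg cg])
    from arg_cong[OF this, of degree] show ?thesis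
      using gen[of t 0] gen[of t 1] gen[of 0 0] gen[of 0 1] that by (simp add: degree_mult_eq)
  qed
  have shift: "generic_degree (f t) (g 0) + wraps d c (g 0) = generic_degree (f (Suc t)) (g 1) + wraps d c (f t)" for t
    using generic_degree_cyc[OF rf cg nz, of t 0] step[of t] step(2)[of 0] by simp
  \<comment> \<open>After \<open>d\<close> steps the selection is the original one, so the shift by one disappears in the sum.\<close>
  have period: "f d = f 0"
    using d by (intro ext) (simp add: f_def cyc_funpow)
  have "(\<Sum>t<d. generic_degree (f (Suc t)) (g 1)) = (\<Sum>t<d. generic_degree (f t) (g 1))"
    using sum.lessThan_Suc_shift[of "\<lambda>t. generic_degree (f t) (g 1)" d] period by simp
  moreover have "(\<Sum>t<d. generic_degree (f t) (g 0) + wraps d c (g 0)) = (\<Sum>t<d. generic_degree (f (Suc t)) (g 1) + wraps d c (f t))"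
    by (intro sum.cong refl shift)
  moreover have "(\<Sum>t<d. wraps d c (f t)) = c"
    unfolding f_def by (rule sum_wraps_orbit[OF d])
  ultimately have "(\<Sum>t<d. generic_degree (f t) (g 0)) + d * wraps d c (g 0) = (\<Sum>t<d. generic_degree (f t) (g 1)) + c"
    by (simp add: sum.distrib)
  moreover have "(\<Sum>t<d. generic_degree (f t) (g 1)) + d * generic_degree (f 0) (g 0) = (\<Sum>t<d. generic_degree (f t) (g 0)) + d * generic_degree (f 0) (g 1)"
  proof -
    have "(\<Sum>t<d. generic_degree (f t) (g 1) + generic_degree (f 0) (g 0)) = (\<Sum>t<d. generic_degree (f t) (g 0) + generic_degree (f 0) (g 1))"
      by (intro sum.cong refl ranks) simp
    then show ?thesis by (simp add: sum.distrib)
  qed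
  ultimately have "d * (wraps d c (g 0) + generic_degree (f 0) (g 0)) = d * generic_degree (f 0) (g 1) + c"
    by (simp add: distrib_left)
  then show ?thesis by (metis dvd_add_right_iff dvd_triv_left)
qed

end

lemma size_dvd_max_rank_blow_up:
  fixes X :: "'a::field mat set"
  assumes "infinite (UNIV :: 'a set)" and X: "matrix_space k n X" and "0 < d"
  shows "d dvd max_rank (blow_up k n d X)"
proof -
  have Y: "blow_up k n d X \<subseteq> carrier_mat (k * d) (n * d)" "blow_up k n d X \<noteq> {}"
    using matrix_space_blow_up[OF X, of d] unfolding matrix_space_def by blast+
  interpret maximal_blow_up_rank k n d "max_rank (blow_up k n d X)" X
    by unfold_locales (use assms max_rank_rank_at_least[OF Y] in auto)
  show ?thesis by (rule size_dvd_rank)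
qed

section \<open>Superadditivity\<close>

lemma blow_up_superadditive:
  fixes X :: "'a::field mat set"
  assumes X: "matrix_space k n X"
    and M: "M \<in> blow_up k n d X" and c: "rank_at_least c M"
    and A: "A \<in> X" and r: "rank_at_least r A"
  obtains N where "N \<in> blow_up k n (d + 1) X" "rank_at_least (c + r) N"
proof -
  have Mc: "M \<in> carrier_mat (k * d) (n * d)" using M by (simp add: blow_up_def)
  have Ac: "A \<in> carrier_mat k n" using A X by (auto simp: matrix_space_def)
  define e where "e = d + 1"
  have "d < e" by (simp add: e_def)
  define N where "N = mat (k * e) (n * e) (\<lambda>(p, q).
     if p mod e < d \<and> q mod e < d then M $$ (p div e * d + p mod e, q div e * d + q mod e)
     else if p mod e = d \<and> q mod e = d then A $$ (p div e, q div e) else 0)"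
  have N: "N \<in> carrier_mat (k * e) (n * e)" by (simp add: N_def)
  have Nval: "N $$ (i * e + a, j * e + b) = (if a < d \<and> b < d then M $$ (i * d + a, j * d + b)
     else if a = d \<and> b = d then A $$ (i, j) else 0)" if "i < k" "j < n" "a < e" "b < e" for i j a b
    using that by (simp add: N_def block_index_less)
  have "slice k n e a b N \<in> X" if ab: "a < e" "b < e" for a b
  proof -
    consider "a < d" "b < d" | "a = d" "b = d" | "a < d" "b = d" | "a = d" "b < d"
      using ab by (force simp: e_def)
    then show ?thesis
    proof cases
      case 1
      then have "slice k n e a b N = slice k n d a b M"
        using ab by (intro eq_matI) (auto simp: slice_def Nval)
      then show ?thesis using M 1 by (simp add: blow_up_def)
    next
      case 2
      then have "slice k n e a b N = A"
        using ab Ac by (intro eq_matI) (auto simp: slice_def Nval)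
      then show ?thesis using A by simp
    next
      case 3
      then have "slice k n e a b N = 0\<^sub>m k n"
        using ab by (intro eq_matI) (auto simp: slice_def Nval)
      then show ?thesis using X by (simp add: matrix_space_def)
    next
      case 4
      then have "slice k n e a b N = 0\<^sub>m k n"
        using ab by (intro eq_matI) (auto simp: slice_def Nval)
      then show ?thesis using X by (simp add: matrix_space_def)
    qed
  qed
  then have "N \<in> blow_up k n (d + 1) X" using N by (simp add: blow_up_def e_def)
  moreover have "rank_at_least (c + r) N"
  proof -
    obtain f g where f: "\<And>x. x < c \<Longrightarrow> f x < k * d" and g: "\<And>x. x < c \<Longrightarrow> g x < n * d"
      and dM: "det (mat c c (\<lambda>(x, y). M $$ (f x, g y))) \<noteq> 0"
      using rank_at_least_imp_minor[OF Mc c] by blast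
    obtain f' g' where f': "\<And>x. x < r \<Longrightarrow> f' x < k" and g': "\<And>x. x < r \<Longrightarrow> g' x < n"
      and dA: "det (mat r r (\<lambda>(x, y). A $$ (f' x, g' y))) \<noteq> 0"
      using rank_at_least_imp_minor[OF Ac r] by blast
    define f2 where "f2 x = (if x < c then f x div d * e + f x mod d else f' (x - c) * e + d)" for x
    define g2 where "g2 x = (if x < c then g x div d * e + g x mod d else g' (x - c) * e + d)" for x
    have fm: "f x div d < k" "f x mod d < d" "f x mod d < e" and gm: "g x div d < n" "g x mod d < d" "g x mod d < e"
      if "x < c" for x
      using f[OF that] g[OF that] div_less_block mod_less_block by (auto simp: e_def less_SucI)
    have f2: "f2 x < k * e" and g2: "g2 x < n * e" if "x < c + r" for x
      using that fm[of x] gm[of x] f'[of "x - c"] g'[of "x - c"] \<open>d < e\<close>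
      by (auto simp: f2_def g2_def intro!: block_index_less)
    have "mat (c + r) (c + r) (\<lambda>(x, y). N $$ (f2 x, g2 y))
      = four_block_mat (mat c c (\<lambda>(x, y). M $$ (f x, g y))) (0\<^sub>m c r) (0\<^sub>m r c) (mat r r (\<lambda>(x, y). A $$ (f' x, g' y)))"
      (is "_ = ?R")
    proof (rule eq_matI)
      fix x y assume "x < dim_row ?R" "y < dim_col ?R"
      then have xy: "x < c + r" "y < c + r" by auto
      show "mat (c + r) (c + r) (\<lambda>(x, y). N $$ (f2 x, g2 y)) $$ (x, y) = ?R $$ (x, y)"
        using xy fm[of x] gm[of y] f'[of "x - c"] g'[of "y - c"] \<open>d < e\<close>
        by (cases "x < c"; cases "y < c") (simp_all add: f2_def g2_def Nval)
    qed auto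
    moreover have "det ?R = det (mat c c (\<lambda>(x, y). M $$ (f x, g y))) * det (mat r r (\<lambda>(x, y). A $$ (f' x, g' y)))"
      by (rule det_four_block_mat_upper_right_zero) auto
    ultimately show ?thesis
      using dM dA f2 g2 by (intro minor_imp_rank_at_least[OF N, of _ f2 g2]) auto
  qed
  ultimately show thesis by (rule that)
qed

section \<open>A blow-up of size d has rank less than 2 d times the rank of the space\<close>

text \<open>For \<open>A = diag(1, 0)\<close> the matrices \<open>F Z E\<close>, \<open>F Z R\<close>, \<open>L Z E\<close>, \<open>L Z R\<close> are the four blocks of \<open>Z\<close>. As \<open>A + s Z\<close>
  has rank at most \<open>r\<close> and \<open>P s = F (A + s Z) E = 1 + s F Z E\<close> is invertible for almost all \<open>s\<close>, the Schur
  complement of \<open>P s\<close> vanishes: \<open>s (L Z R) = s\<^sup>2 (L Z E) (P s)\<^sup>-\<^sup>1 (F Z R)\<close>. Multiplied by \<open>det (P s)\<close> this is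
  an identity of polynomials in \<open>s\<close>. Its lowest coefficients are the two claims.\<close>

lemma compressions_of_maximal_rank:
  fixes X :: "'a::field mat set"
  assumes inf: "infinite (UNIV :: 'a set)" and X: "matrix_space k n X"
    and max: "\<And>Z c. Z \<in> X \<Longrightarrow> rank_at_least c Z \<Longrightarrow> c \<le> r"
    and A: "A \<in> X" and F: "F \<in> carrier_mat r k" and E: "E \<in> carrier_mat n r"
    and FAE: "F * A * E = 1\<^sub>m r" and AEFA: "A * E * F * A = A"
    and Z: "Z \<in> X"
  defines "L \<equiv> 1\<^sub>m k - A * E * F" and "R \<equiv> 1\<^sub>m n - E * F * A"
  shows "L * Z * R = 0\<^sub>m k n" and "(L * Z * E) * (F * Z * R) = 0\<^sub>m k n"
proof -
  have Ac: "A \<in> carrier_mat k n" and Zc: "Z \<in> carrier_mat k n"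
    using A Z X by (auto simp: matrix_space_def)
  note [simp] = carrier_matD[OF Ac] carrier_matD[OF Zc] carrier_matD[OF F] carrier_matD[OF E]
  have [simp]: "dim_row L = k" "dim_col L = k" "dim_row R = n" "dim_col R = n"
    by (auto simp: L_def R_def)
  have LA: "L * A = 0\<^sub>m k n"
  proof -
    have "L * A = A - A * E * F * A" by (simp add: L_def mat_dim_simps)
    then show ?thesis by (simp add: AEFA minus_self_mat)
  qed
  have AR: "A * R = 0\<^sub>m k n"
  proof -
    have "A * R = A - A * E * F * A" by (simp add: R_def mat_dim_simps)
    then show ?thesis by (simp add: AEFA minus_self_mat)
  qed
  define B C D where "B = F * Z * R" and "C = L * Z * E" and "D = L * Z * R"
  have Bc: "B \<in> carrier_mat r n" and Cc: "C \<in> carrier_mat k r" and Dc: "D \<in> carrier_mat k n"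
    by (auto simp: B_def C_def D_def intro!: carrier_matI)
  define P where "P s = 1\<^sub>m r + s \<cdot>\<^sub>m (F * Z * E)" for s
  have Pc: "P s \<in> carrier_mat r r" for s by (auto simp: P_def intro!: carrier_matI)
  define S where "S s = C * adj_mat (P s) * B" for s
  have adjc: "adj_mat (P s) \<in> carrier_mat r r" for s by (rule adj_mat(1)[OF Pc])
  have key: "det (P s) \<cdot>\<^sub>m (s \<cdot>\<^sub>m D) = s \<cdot>\<^sub>m (s \<cdot>\<^sub>m S s)" if nz: "det (P s) \<noteq> 0" for s
  proof -
    define N where "N = A + s \<cdot>\<^sub>m Z"
    have N: "N \<in> X" using A Z X by (simp add: N_def matrix_space_def)
    have Nc: "N \<in> carrier_mat k n" by (auto simp: N_def intro!: carrier_matI)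
    have [simp]: "dim_row N = k" "dim_col N = n" using Nc by auto
    have FNE: "F * N * E = P s" and LNE: "L * N * E = s \<cdot>\<^sub>m C"
      and FNR: "F * N * R = s \<cdot>\<^sub>m B" and LNR: "L * N * R = s \<cdot>\<^sub>m D"
    proof -
      have FAE': "F * (A * E) = 1\<^sub>m r" using FAE by (simp add: assoc_mult_mat_dim)
      have "L * (A * E) = 0\<^sub>m k r"
      proof -
        have "L * (A * E) = L * A * E" by (simp add: assoc_mult_mat_dim)
        then show ?thesis by (simp add: LA)
      qed
      note LAE = this
      have zero: "0\<^sub>m a b + M = M" if "dim_row M = a" "dim_col M = b" for a b and M :: "'a mat"
        using that by (intro eq_matI) auto
      have split: "G * N * H = G * (A * H) + s \<cdot>\<^sub>m (G * Z * H)" if "dim_col G = k" "dim_row H = n" for G H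
        using that by (simp add: N_def mat_dim_simps mult_smult_mat_dim smult_mult_mat_dim)
      show "F * N * E = P s" by (simp add: split FAE' P_def)
      show "L * N * E = s \<cdot>\<^sub>m C" by (simp add: split LAE zero C_def)
      show "F * N * R = s \<cdot>\<^sub>m B" by (simp add: split AR zero B_def)
      show "L * N * R = s \<cdot>\<^sub>m D" by (simp add: split AR zero D_def)
    qed
    obtain c F' E' where F': "F' \<in> carrier_mat c k" and E': "E' \<in> carrier_mat n c"
      and "F' * N * E' = 1\<^sub>m c" and NN: "N * E' * F' * N = N"
      by (rule generalized_inverse_exists[OF Nc])
    then have "rank_at_least c N" unfolding rank_at_least_def by auto
    then have "c \<le> r" by (rule max[OF N])
    have "rank_at_least r N" using nz FNE by (intro rank_at_leastI_det[OF Nc F E]) simp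
    define U V where "U = N * E'" and "V = F' * N"
    have Uc: "U \<in> carrier_mat k c" and Vc: "V \<in> carrier_mat c n"
      using E' F' by (auto simp: U_def V_def intro!: carrier_matI)
    have NUV: "N = U * V"
      using NN E' F' by (simp add: U_def V_def assoc_mult_mat_dim)
    \<comment> \<open>The rank is exactly \<open>r\<close>, so that \<open>P s\<close> splits into two square factors.\<close>
    have "r \<le> c" by (rule rank_at_least_factor_le[OF \<open>rank_at_least r N\<close> NUV Uc Vc])
    with \<open>c \<le> r\<close> have "c = r" by simp
    note [simp] = carrier_matD[OF Uc[unfolded \<open>c = r\<close>]] carrier_matD[OF Vc[unfolded \<open>c = r\<close>]]
      carrier_matD[OF adjc]
    define G H where "G = F * U" and "H = V * E"
    have Gc: "G \<in> carrier_mat r r" and Hc: "H \<in> carrier_mat r r"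
      by (auto simp: G_def H_def intro!: carrier_matI)
    note [simp] = carrier_matD[OF Gc] carrier_matD[OF Hc]
    have GH: "P s = G * H"
      using FNE by (simp add: NUV G_def H_def assoc_mult_mat_dim)
    have "det G \<noteq> 0" using nz det_mult[OF Gc Hc] GH by auto
    from det_non_zero_imp_unit[OF Gc this, of "()"] obtain G' where
      G': "G' \<in> carrier_mat r r" "G' * G = 1\<^sub>m r"
      unfolding Units_def ring_mat_def by auto
    note [simp] = carrier_matD[OF G'(1)]
    have GHJG: "G * (H * (adj_mat (P s) * G)) = det (P s) \<cdot>\<^sub>m G"
    proof -
      have "G * (H * (adj_mat (P s) * G)) = (G * H) * adj_mat (P s) * G"
        by (simp add: assoc_mult_mat_dim)
      also have "\<dots> = (P s * adj_mat (P s)) * G" by (simp only: GH[symmetric])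
      also have "\<dots> = det (P s) \<cdot>\<^sub>m G"
        unfolding adj_mat(2)[OF Pc] by (simp add: smult_mult_mat_dim)
      finally show ?thesis .
    qed
    have "H * (adj_mat (P s) * G) = (G' * G) * (H * (adj_mat (P s) * G))"
      by (simp add: G'(2))
    also have "\<dots> = G' * (G * (H * (adj_mat (P s) * G)))" by (simp add: assoc_mult_mat_dim)
    also have "\<dots> = det (P s) \<cdot>\<^sub>m (G' * G)" unfolding GHJG by (simp add: mult_smult_mat_dim)
    finally have HaG: "H * (adj_mat (P s) * G) = det (P s) \<cdot>\<^sub>m 1\<^sub>m r"
      unfolding G'(2) .
    have "(s \<cdot>\<^sub>m C) * (adj_mat (P s) * (s \<cdot>\<^sub>m B)) = L * U * (H * (adj_mat (P s) * G)) * (V * R)"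
      unfolding LNE[symmetric] FNR[symmetric] by (simp add: NUV G_def H_def assoc_mult_mat_dim)
    also have "\<dots> = det (P s) \<cdot>\<^sub>m (L * U * (V * R))"
      unfolding HaG
      by (simp add: mult_smult_mat_dim smult_mult_mat_dim)
    also have "L * U * (V * R) = s \<cdot>\<^sub>m D"
      unfolding LNR[symmetric] by (simp add: NUV assoc_mult_mat_dim)
    also have "(s \<cdot>\<^sub>m C) * (adj_mat (P s) * (s \<cdot>\<^sub>m B)) = s \<cdot>\<^sub>m (s \<cdot>\<^sub>m S s)"
      using Cc Bc adjc
      by (simp add: S_def mult_smult_mat_dim smult_mult_mat_dim assoc_mult_mat_dim)
    finally show ?thesis by simp
  qed
  have Ppoly: "poly_mat r r P"
    unfolding P_def by (intro poly_mat_add poly_mat_smult poly_mat_const poly_fun_id) (auto intro!: carrier_matI)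
  have Spoly: "poly_mat k n S"
    unfolding S_def
    by (rule poly_mat_mult[OF poly_mat_mult[OF poly_mat_const[OF Cc] poly_mat_adj[OF Ppoly]] poly_mat_const[OF Bc]])
  have P0: "P 0 = 1\<^sub>m r" by (rule eq_matI) (auto simp: P_def)
  have entries: "D $$ (i, j) = 0 \<and> S 0 $$ (i, j) = 0" if ij: "i < k" "j < n" for i j
  proof -
    have Spf: "poly_fun (\<lambda>s. S s $$ (i, j))" using Spoly ij unfolding poly_mat_def by blast
    have Sd: "dim_row (S s) = k" "dim_col (S s) = n" for s using poly_mat_dim[OF Spoly] by auto
    have det: "poly_fun (\<lambda>s. det (P s))" by (rule poly_fun_det[OF Ppoly])
    note closed = poly_fun_mult poly_fun_id poly_fun_const det Spf
    have 1: "(\<lambda>s. det (P s) * (s * D $$ (i, j))) = (\<lambda>s. s * (s * S s $$ (i, j)))"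
    proof (rule poly_fun_eqI[where a = 0, OF inf _ _ det])
      fix s assume "det (P s) \<noteq> 0"
      from arg_cong[OF key[OF this], of "\<lambda>T. T $$ (i, j)"]
      show "det (P s) * (s * D $$ (i, j)) = s * (s * S s $$ (i, j))"
        using ij Dc Sd by simp
    qed (simp_all add: closed P0)
    have 2: "(\<lambda>s. det (P s) * D $$ (i, j)) = (\<lambda>s. s * S s $$ (i, j))"
    proof (rule poly_fun_eqI[where a = 1, OF inf _ _ poly_fun_id])
      fix s :: 'a assume "s \<noteq> 0"
      then show "det (P s) * D $$ (i, j) = s * S s $$ (i, j)" using fun_cong[OF 1, of s] by simp
    qed (simp_all add: closed)
    have D0: "D $$ (i, j) = 0" using fun_cong[OF 2, of 0] P0 by simp
    have "(\<lambda>s. S s $$ (i, j)) = (\<lambda>s. 0)"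
    proof (rule poly_fun_eqI[where a = 1, OF inf _ _ poly_fun_id])
      fix s :: 'a assume "s \<noteq> 0"
      then show "S s $$ (i, j) = 0" using fun_cong[OF 2, of s] D0 by simp
    qed (simp_all add: closed)
    then have "S 0 $$ (i, j) = 0" by (rule fun_cong)
    with D0 show ?thesis by blast
  qed
  show "L * Z * R = 0\<^sub>m k n"
    unfolding D_def[symmetric] using entries Dc by (intro eq_matI) auto
  have "1 \<cdot>\<^sub>m 1\<^sub>m r = (1\<^sub>m r :: 'a mat)" by (intro eq_matI) auto
  then have "adj_mat (1\<^sub>m r) = (1\<^sub>m r :: 'a mat)"
    using adj_mat(1,3)[of "1\<^sub>m r :: 'a mat" r] by simp
  then have "S 0 = C * B"
    using Cc by (simp add: S_def P0)
  moreover have "S 0 = 0\<^sub>m k n"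
    using entries poly_mat_dim[OF Spoly] by (intro eq_matI) auto
  ultimately show "(L * Z * E) * (F * Z * R) = 0\<^sub>m k n" by (simp add: B_def C_def)
qed

text \<open>The two ranks are attained at different members of the space. A generic member attains both, and
  there the product of the two compressions is zero.\<close>

lemma compression_ranks_le:
  fixes X :: "'a::field mat set"
  assumes inf: "infinite (UNIV :: 'a set)" and X: "matrix_space k n X"
    and max: "\<And>Z c. Z \<in> X \<Longrightarrow> rank_at_least c Z \<Longrightarrow> c \<le> r"
    and A: "A \<in> X" and F: "F \<in> carrier_mat r k" and E: "E \<in> carrier_mat n r"
    and FAE: "F * A * E = 1\<^sub>m r" and AEFA: "A * E * F * A = A"
  defines "L \<equiv> 1\<^sub>m k - A * E * F" and "R \<equiv> 1\<^sub>m n - E * F * A"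
  assumes Z1: "Z1 \<in> X" "rank_at_least b (F * Z1 * R)"
    and Z2: "Z2 \<in> X" "rank_at_least c (L * Z2 * E)"
  shows "c + b \<le> r"
proof -
  have Ac: "A \<in> carrier_mat k n" using A X by (auto simp: matrix_space_def)
  have Xd: "dim_row Z = k" "dim_col Z = n" if "Z \<in> X" for Z
    using X that by (auto simp: matrix_space_def)
  note [simp] = carrier_matD[OF Ac] carrier_matD[OF F] carrier_matD[OF E]
  have L: "L \<in> carrier_mat k k" and R: "R \<in> carrier_mat n n"
    by (auto simp: L_def R_def intro!: carrier_matI)
  note [simp] = carrier_matD[OF L] carrier_matD[OF R]
  obtain F1 E1 where F1: "F1 \<in> carrier_mat b r" and E1: "E1 \<in> carrier_mat n b" and 1: "F1 * (F * Z1 * R) * E1 = 1\<^sub>m b"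
    using Z1 unfolding rank_at_least_def by auto
  obtain F2 E2 where F2: "F2 \<in> carrier_mat c k" and E2: "E2 \<in> carrier_mat r c" and 2: "F2 * (L * Z2 * E) * E2 = 1\<^sub>m c"
    using Z2 unfolding rank_at_least_def by auto
  define \<phi> where "\<phi> i Z = (if i then det (F1 * (F * Z * R) * E1) else det (F2 * (L * Z * E) * E2))" for i Z
  have "\<exists>Z\<in>X. \<forall>i\<in>UNIV. \<phi> i Z \<noteq> 0"
  proof (rule generic_point[OF inf])
    show "X \<subseteq> carrier_mat k n" "X \<noteq> {}" using X A by (auto simp: matrix_space_def)
    show "mat_line M N t \<in> X" if "M \<in> X" "N \<in> X" for M N t
      using that X by (simp add: matrix_space_def mat_line_def)
    show "poly_fun (\<lambda>t. \<phi> i (mat_line M N t))" if "M \<in> X" "N \<in> X" for i M N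
    proof -
      have line: "poly_mat k n (mat_line M N)"
        using that X by (intro poly_mat_line) (auto simp: matrix_space_def)
      note c = poly_mat_const
      have "poly_mat b b (\<lambda>t. F1 * (F * mat_line M N t * R) * E1)"
        by (rule poly_mat_mult[OF poly_mat_mult[OF c[OF F1] poly_mat_mult[OF poly_mat_mult[OF c[OF F] line] c[OF R]]] c[OF E1]])
      moreover have "poly_mat c c (\<lambda>t. F2 * (L * mat_line M N t * E) * E2)"
        by (rule poly_mat_mult[OF poly_mat_mult[OF c[OF F2] poly_mat_mult[OF poly_mat_mult[OF c[OF L] line] c[OF E]]] c[OF E2]])
      ultimately show ?thesis by (cases i) (simp_all add: \<phi>_def poly_fun_det)
    qed
    show "\<exists>M\<in>X. \<phi> i M \<noteq> 0" for i
    proof (cases i)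
      case True
      then show ?thesis by (intro bexI[OF _ Z1(1)]) (simp add: \<phi>_def 1)
    next
      case False
      then show ?thesis by (intro bexI[OF _ Z2(1)]) (simp add: \<phi>_def 2)
    qed
  qed auto
  then obtain Z where Z: "Z \<in> X" and "\<phi> True Z \<noteq> 0" "\<phi> False Z \<noteq> 0" by auto
  note [simp] = Xd[OF Z]
  have Bc: "F * Z * R \<in> carrier_mat r n" and Cc: "L * Z * E \<in> carrier_mat k r"
    by (auto intro!: carrier_matI)
  have "rank_at_least b (F * Z * R)"
    using \<open>\<phi> True Z \<noteq> 0\<close> by (intro rank_at_leastI_det[OF Bc F1 E1]) (simp add: \<phi>_def)
  moreover have "rank_at_least c (L * Z * E)"
    using \<open>\<phi> False Z \<noteq> 0\<close> by (intro rank_at_leastI_det[OF Cc F2 E2]) (simp add: \<phi>_def)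
  moreover have "(L * Z * E) * (F * Z * R) = 0\<^sub>m k n"
    unfolding L_def R_def
    by (rule compressions_of_maximal_rank(2)[OF inf X max A F E FAE AEFA Z])
  ultimately show ?thesis by (intro rank_product_zero[OF Cc Bc])
qed

lemma blow_up_of_zero:
  fixes X :: "'a::field mat set"
  assumes X: "matrix_space k n X"
    and max: "\<And>Z c. Z \<in> X \<Longrightarrow> rank_at_least c Z \<Longrightarrow> c = 0"
    and M: "M \<in> blow_up k n d X" "rank_at_least c M"
  shows "c = 0"
proof -
  have zero: "Z = 0\<^sub>m k n" if "Z \<in> X" for Z
  proof -
    have "Z \<in> carrier_mat k n" using that X by (auto simp: matrix_space_def)
    then obtain r U V where "rank_at_least r Z" "U \<in> carrier_mat k r" "V \<in> carrier_mat r n" "Z = U * V"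
      by (rule rank_factorization)
    moreover from this have "r = 0" using max[OF that] by blast
    ultimately show ?thesis by (intro eq_matI) (auto simp: scalar_prod_def)
  qed
  have "slice k n d a b (0\<^sub>m (k * d) (n * d)) = (0\<^sub>m k n :: 'a mat)" if "a < d" "b < d" for a b
    using that by (intro eq_matI) (auto simp: slice_def block_index_less)
  moreover have "slice k n d a b M = 0\<^sub>m k n" if "a < d" "b < d" for a b
    using M(1) that by (intro zero) (simp add: blow_up_def)
  ultimately have "slice k n d a b M = slice k n d a b (0\<^sub>m (k * d) (n * d))" if "a < d" "b < d" for a b
    using that by metis
  moreover have "M \<in> carrier_mat (k * d) (n * d)" using M(1) by (simp add: blow_up_def)
  ultimately have "M = 0\<^sub>m (k * d) (n * d)"
    by (intro eq_mat_slices[of M k d n]) auto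
  also have "\<dots> = 0\<^sub>m (k * d) 0 * 0\<^sub>m 0 (n * d)" by (intro eq_matI) (auto simp: scalar_prod_def)
  finally show ?thesis
    using rank_at_least_factor_le[OF M(2), of "0\<^sub>m (k * d) 0" "0\<^sub>m 0 (n * d)" "k * d" 0 "n * d"] by simp
qed

text \<open>Here \<open>Z = A E (F Z R) + (Z E) (F A)\<close> and \<open>Z = (L Z E) (F A) + A E (F Z)\<close> for all \<open>Z\<close> in the space, as
  \<open>L Z R = 0\<close>. Tensored with the \<open>d \<times> d\<close> matrices, each of the two formulas bounds the rank of a blow-up matrix by
  that of a blow-up matrix of one compression plus \<open>d r\<close>. The induction hypothesis is applied to
  the compression of rank at most \<open>r div 2\<close>. A vanishing compression has a vanishing blow-up, so the bound
  stays strict in that case as well.\<close>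

lemma blow_up_rank_less:
  fixes X :: "'a::field mat set"
  assumes inf: "infinite (UNIV :: 'a set)" and d: "0 < d"
    and X: "matrix_space k n X"
    and max: "\<And>Z c. Z \<in> X \<Longrightarrow> rank_at_least c Z \<Longrightarrow> c \<le> r"
    and M: "M \<in> blow_up k n d X" "rank_at_least c M" and "0 < c"
  shows "c < 2 * d * r"
  using X max M \<open>0 < c\<close>
proof (induction r arbitrary: k n X M c rule: less_induct)
  case (less r)
  note X = less.prems(1) and M = less.prems(3,4) and \<open>0 < c\<close>
  have Mc: "M \<in> carrier_mat (k * d) (n * d)" using M by (simp add: blow_up_def)
  have "0\<^sub>m k n \<in> X" using X by (simp add: matrix_space_def)
  moreover have "rank_at_least 0 (0\<^sub>m k n :: 'a mat)"
    by (rule minor_imp_rank_at_least[of _ k n _ "\<lambda>_. 0" "\<lambda>_. 0"]) auto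
  ultimately obtain r' where "\<exists>Z\<in>X. rank_at_least r' Z"
    and max': "\<And>Z c. Z \<in> X \<Longrightarrow> rank_at_least c Z \<Longrightarrow> c \<le> r'"
    using ex_has_greatest_nat[of "\<lambda>c. \<exists>Z\<in>X. rank_at_least c Z" 0 id r] less.prems(2) by force
  then obtain A where A: "A \<in> X" "rank_at_least r' A" by blast
  have "r' \<le> r" using less.prems(2)[OF A] .
  have "0 < r'"
  proof (rule ccontr)
    assume "\<not> 0 < r'"
    then have "c' = 0" if "Z \<in> X" "rank_at_least c' Z" for Z c' using max'[OF that] by simp
    from blow_up_of_zero[OF X this M] show False using \<open>0 < c\<close> by simp
  qed
  have Ac: "A \<in> carrier_mat k n" using A X by (auto simp: matrix_space_def)
  obtain c0 F E where F: "F \<in> carrier_mat c0 k" and E: "E \<in> carrier_mat n c0"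
    and FAE: "F * A * E = 1\<^sub>m c0" and AEFA: "A * E * F * A = A"
    by (rule generalized_inverse_exists[OF Ac])
  have "rank_at_least c0 A" unfolding rank_at_least_def using Ac F E FAE by auto
  then have "c0 \<le> r'" using max' A by blast
  moreover have "r' \<le> c0"
    using rank_at_least_factor_le[OF A(2), of "A * E" "F * A" k c0 n] AEFA Ac F E
    by (simp add: assoc_mult_mat_dim)
  ultimately have "c0 = r'" by simp
  note F = F[unfolded \<open>c0 = r'\<close>] and E = E[unfolded \<open>c0 = r'\<close>] and FAE = FAE[unfolded \<open>c0 = r'\<close>]
  note [simp] = carrier_matD[OF Ac] carrier_matD[OF F] carrier_matD[OF E]
  define L R where "L = 1\<^sub>m k - A * E * F" and "R = 1\<^sub>m n - E * F * A"
  have L: "L \<in> carrier_mat k k" and R: "R \<in> carrier_mat n n"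
    by (auto simp: L_def R_def intro!: carrier_matI)
  note [simp] = carrier_matD[OF L] carrier_matD[OF R]
  have LZR: "L * Z * R = 0\<^sub>m k n" if "Z \<in> X" for Z
    unfolding L_def R_def by (rule compressions_of_maximal_rank(1)[OF inf X max' A(1) F E FAE AEFA that])
  have bound: "b + r' * d < 2 * d * r" if "b = 0 \<or> b < 2 * d * (r' div 2)" for b
  proof -
    have "2 * d * (r' div 2) = d * (2 * (r' div 2))" by (simp only: mult_ac)
    also have "\<dots> \<le> d * r'" by (intro mult_le_mono2) simp
    finally have "2 * d * (r' div 2) \<le> d * r'" .
    moreover have "0 < d * r'" using \<open>0 < r'\<close> d by simp
    ultimately have "b < d * r'" using that by linarith
    then have "b + r' * d < d * r' + d * r'" by (simp add: mult.commute)
    also have "\<dots> = 2 * d * r'" by simp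
    also have "\<dots> \<le> 2 * d * r" by (intro mult_le_mono2 \<open>r' \<le> r\<close>)
    finally show ?thesis .
  qed
  have "r' div 2 < r" using \<open>0 < r'\<close> \<open>r' \<le> r\<close> by simp
  have "(\<forall>Z\<in>X. \<forall>b. rank_at_least b (F * Z * R) \<longrightarrow> b \<le> r' div 2)
    \<or> (\<forall>Z\<in>X. \<forall>b. rank_at_least b (L * Z * E) \<longrightarrow> b \<le> r' div 2)"
  proof (rule ccontr)
    assume "\<not> ?thesis"
    then obtain Z1 b1 Z2 b2 where Z: "Z1 \<in> X" "rank_at_least b1 (F * Z1 * R)"
      "Z2 \<in> X" "rank_at_least b2 (L * Z2 * E)" and b: "r' div 2 < b1" "r' div 2 < b2"
      by (auto simp: not_le)
    have "b2 + b1 \<le> r'"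
      by (rule compression_ranks_le[OF inf X max' A(1) F E FAE AEFA Z(1) Z(2)[unfolded R_def] Z(3) Z(4)[unfolded L_def]])
    then show False using b by linarith
  qed
  then show ?case
  proof
    assume B: "\<forall>Z\<in>X. \<forall>b. rank_at_least b (F * Z * R) \<longrightarrow> b \<le> r' div 2"
    let ?N = "kronecker F (1\<^sub>m d) * M * kronecker R (1\<^sub>m d)"
    have N: "?N \<in> blow_up r' n d ((\<lambda>Z. F * Z * R) ` X)" by (rule blow_up_image(1)[OF M(1) F R])
    then have Nc: "?N \<in> carrier_mat (r' * d) (n * d)" by (simp add: blow_up_def)
    obtain b U V where b: "rank_at_least b ?N" and U: "U \<in> carrier_mat (r' * d) b" and V: "V \<in> carrier_mat b (n * d)"
      and UV: "?N = U * V" by (rule rank_factorization[OF Nc])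
    have "b = 0 \<or> b < 2 * d * (r' div 2)"
      using less.IH[OF \<open>r' div 2 < r\<close> matrix_space_image[OF X F R] _ N b] B by auto
    moreover have "c \<le> b + r' * d"
    proof -
      let ?AE = "kronecker (A * E) (1\<^sub>m d)" and ?E = "kronecker E (1\<^sub>m d)" and ?FA = "kronecker (F * A) (1\<^sub>m d)"
      have AEc: "A * E \<in> carrier_mat k r'" and FAc: "F * A \<in> carrier_mat r' n" by (auto intro!: carrier_matI)
      have kc: "?AE \<in> carrier_mat (k * d) (r' * d)" "?E \<in> carrier_mat (n * d) (r' * d)" "?FA \<in> carrier_mat (r' * d) (n * d)"
        using AEc FAc E by (auto intro!: kronecker_carrier)
      have MEc: "M * ?E \<in> carrier_mat (k * d) (r' * d)" using Mc kc by auto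
      have "M = ?AE * ?N + M * ?E * ?FA"
      proof (rule eq_mat_slices[OF Mc])
        fix a b' assume ab: "a < d" "b' < d"
        define Z where "Z = slice k n d a b' M"
        have Z: "Z \<in> X" using M(1) ab by (simp add: Z_def blow_up_def)
        then have [simp]: "dim_row Z = k" "dim_col Z = n" using X by (auto simp: matrix_space_def)
        have "slice k n d a b' (?AE * ?N + M * ?E * ?FA) = A * E * (F * Z * R) + Z * E * (F * A)"
          unfolding slice_add[OF mult_carrier_mat[OF kc(1) Nc] mult_carrier_mat[OF MEc kc(3)] ab]
            slice_kronecker_mult[OF AEc Nc ab] slice_mult_kronecker[OF FAc MEc ab]
            slice_mult_kronecker[OF E Mc ab] blow_up_image(2)[OF M(1) F R ab] Z_def ..
        also have "\<dots> = Z"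
        proof -
          have "L * Z * R = Z * R - A * E * (F * Z * R)" by (simp add: L_def mat_dim_simps)
          then have "Z * R - A * E * (F * Z * R) = 0\<^sub>m k n" using LZR[OF Z] by simp
          moreover have "Z * R = Z - Z * E * (F * A)" by (simp add: R_def mat_dim_simps)
          ultimately have eq: "Z - Z * E * (F * A) - A * E * (F * Z * R) = 0\<^sub>m k n" by simp
          show ?thesis
          proof (rule eq_matI)
            fix i j assume "i < dim_row Z" "j < dim_col Z"
            then show "(A * E * (F * Z * R) + Z * E * (F * A)) $$ (i, j) = Z $$ (i, j)"
              using arg_cong[OF eq, of "\<lambda>T. T $$ (i, j)"] by (simp add: algebra_simps del: index_mult_mat(1))
          qed auto
        qed
        finally show "slice k n d a b' M = slice k n d a b' (?AE * ?N + M * ?E * ?FA)" by (simp add: Z_def)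
      qed (use kc Nc MEc in auto)
      then have sum: "rank_at_least c ((?AE * U) * V + M * ?E * ?FA)"
        using M(2) UV kc U V by (simp add: assoc_mult_mat_dim)
      show ?thesis
        by (rule rank_sum_le[OF sum mult_carrier_mat[OF kc(1) U] MEc V kc(3)])
    qed
    ultimately show ?thesis using bound[of b] by simp
  next
    assume C: "\<forall>Z\<in>X. \<forall>b. rank_at_least b (L * Z * E) \<longrightarrow> b \<le> r' div 2"
    let ?N = "kronecker L (1\<^sub>m d) * M * kronecker E (1\<^sub>m d)"
    have N: "?N \<in> blow_up k r' d ((\<lambda>Z. L * Z * E) ` X)" by (rule blow_up_image(1)[OF M(1) L E])
    then have Nc: "?N \<in> carrier_mat (k * d) (r' * d)" by (simp add: blow_up_def)
    obtain b U V where b: "rank_at_least b ?N" and U: "U \<in> carrier_mat (k * d) b" and V: "V \<in> carrier_mat b (r' * d)"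
      and UV: "?N = U * V" by (rule rank_factorization[OF Nc])
    have "b = 0 \<or> b < 2 * d * (r' div 2)"
      using less.IH[OF \<open>r' div 2 < r\<close> matrix_space_image[OF X L E] _ N b] C by auto
    moreover have "c \<le> b + r' * d"
    proof -
      let ?AE = "kronecker (A * E) (1\<^sub>m d)" and ?F = "kronecker F (1\<^sub>m d)" and ?FA = "kronecker (F * A) (1\<^sub>m d)"
      have AEc: "A * E \<in> carrier_mat k r'" and FAc: "F * A \<in> carrier_mat r' n" by (auto intro!: carrier_matI)
      have kc: "?AE \<in> carrier_mat (k * d) (r' * d)" "?F \<in> carrier_mat (r' * d) (k * d)" "?FA \<in> carrier_mat (r' * d) (n * d)"
        using AEc FAc F by (auto intro!: kronecker_carrier)
      have FMc: "?F * M \<in> carrier_mat (r' * d) (n * d)" using Mc kc by auto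
      have "M = ?N * ?FA + ?AE * (?F * M)"
      proof (rule eq_mat_slices[OF Mc])
        fix a b' assume ab: "a < d" "b' < d"
        define Z where "Z = slice k n d a b' M"
        have Z: "Z \<in> X" using M(1) ab by (simp add: Z_def blow_up_def)
        then have [simp]: "dim_row Z = k" "dim_col Z = n" using X by (auto simp: matrix_space_def)
        have "slice k n d a b' (?N * ?FA + ?AE * (?F * M)) = L * Z * E * (F * A) + A * E * (F * Z)"
          unfolding slice_add[OF mult_carrier_mat[OF Nc kc(3)] mult_carrier_mat[OF kc(1) FMc] ab]
            slice_mult_kronecker[OF FAc Nc ab] slice_kronecker_mult[OF AEc FMc ab]
            slice_kronecker_mult[OF F Mc ab] blow_up_image(2)[OF M(1) L E ab] Z_def ..
        also have "\<dots> = Z"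
        proof -
          have "L * Z * R = L * Z - L * Z * E * (F * A)" by (simp add: R_def mat_dim_simps)
          then have "L * Z - L * Z * E * (F * A) = 0\<^sub>m k n" using LZR[OF Z] by simp
          moreover have "L * Z = Z - A * E * (F * Z)" by (simp add: L_def mat_dim_simps)
          ultimately have eq: "Z - A * E * (F * Z) - L * Z * E * (F * A) = 0\<^sub>m k n" by simp
          show ?thesis
          proof (rule eq_matI)
            fix i j assume "i < dim_row Z" "j < dim_col Z"
            then show "(L * Z * E * (F * A) + A * E * (F * Z)) $$ (i, j) = Z $$ (i, j)"
              using arg_cong[OF eq, of "\<lambda>T. T $$ (i, j)"] by (simp add: algebra_simps del: index_mult_mat(1))
          qed auto
        qed
        finally show "slice k n d a b' M = slice k n d a b' (?N * ?FA + ?AE * (?F * M))" by (simp add: Z_def)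
      qed (use kc Nc FMc in auto)
      then have sum: "rank_at_least c (U * (V * ?FA) + ?AE * (?F * M))"
        using M(2) UV kc U V by (simp add: assoc_mult_mat_dim)
      show ?thesis
        by (rule rank_sum_le[OF sum U kc(1) mult_carrier_mat[OF V kc(3)] FMc])
    qed
    ultimately show ?thesis using bound[of b] by simp
  qed
qed

section \<open>Monotonicity\<close>

theorem proposition1p12:
  fixes \<X> :: "'a::field mat set" and k n d :: nat
  assumes "infinite (UNIV :: 'a set)"
    and "subspace class_ring \<X> (module_mat TYPE('a) k n)"
    and "d \<ge> 1"
    and "real d \<ge> real n / 2 - 1"
  shows "real (max_rank (tensor_blow_up k n (d + 1) \<X>)) / real (d + 1)
           \<ge> real (max_rank (tensor_blow_up k n d \<X>)) / real d"
proof -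
  have X: "matrix_space k n \<X>" by (rule matrix_space_subspace[OF assms(2)])
  have d: "0 < d" using assms(3) by simp
  have n: "n \<le> 2 * d + 2" using assms(4) by linarith
  have Xc: "\<X> \<subseteq> carrier_mat k n" "\<X> \<noteq> {}" using X by (auto simp: matrix_space_def)
  have Y: "blow_up k n e \<X> \<subseteq> carrier_mat (k * e) (n * e)" "blow_up k n e \<X> \<noteq> {}" for e
    using matrix_space_blow_up[OF X, of e] unfolding matrix_space_def by blast+
  obtain s where s: "max_rank (blow_up k n d \<X>) = d * s"
    using size_dvd_max_rank_blow_up[OF assms(1) X d] by (auto elim: dvdE)
  obtain t where t: "max_rank (blow_up k n (d + 1) \<X>) = (d + 1) * t"
    using size_dvd_max_rank_blow_up[OF assms(1) X, of "d + 1"] by (auto elim: dvdE)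
  define r where "r = max_rank \<X>"
  obtain M where M: "M \<in> blow_up k n d \<X>" "rank_at_least (d * s) M"
    using max_rank_rank_at_least(1)[OF Y[of d]] s by auto
  obtain A where A: "A \<in> \<X>" "rank_at_least r A"
    using max_rank_rank_at_least(1)[OF Xc] by (auto simp: r_def)
  have "s \<le> t"
  proof (cases "s = 0")
    case False
    have "M \<in> carrier_mat (k * d) (n * d)" using M by (simp add: blow_up_def)
    from rank_at_least_le_cols[OF this M(2)] have "s \<le> n" using d by (simp add: mult.commute)
    obtain N where "N \<in> blow_up k n (d + 1) \<X>" "rank_at_least (d * s + r) N"
      by (rule blow_up_superadditive[OF X M A])
    then have "d * s + r \<le> (d + 1) * t"
      using max_rank_rank_at_least(2)[OF Y[of "d + 1"]] t by auto
    have "d * s < 2 * d * r"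
      by (rule blow_up_rank_less[OF assms(1) d X _ M]) (use max_rank_rank_at_least(2)[OF Xc] False d in \<open>auto simp: r_def\<close>)
    then have "s < 2 * r" by simp
    show ?thesis
    proof (rule ccontr)
      assume "\<not> s \<le> t"
      then have "t \<le> s - 1" by simp
      then have "(d + 1) * t \<le> (d + 1) * (s - 1)" by (rule mult_le_mono2)
      also have "\<dots> = d * s + s - (d + 1)"
        by (simp add: algebra_simps diff_mult_distrib2)
      finally have "d * s + r \<le> d * s + s - (d + 1)" using \<open>d * s + r \<le> (d + 1) * t\<close> by simp
      then show False using \<open>s < 2 * r\<close> \<open>s \<le> n\<close> n by linarith
    qed
  qed simp
  moreover have "real ((d + 1) * t) / real (d + 1) = real t"
    unfolding of_nat_mult by (rule nonzero_mult_div_cancel_left) simp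
  ultimately show ?thesis
    unfolding tensor_blow_up_eq_blow_up[OF X] s t using d by simp
qed

end
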